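(* Let $X=N+A$ be a local submartingale of class $(\Sigma)$, with only negative jumps, such that $A_\infty=\infty$ almost surely. For $q>p>0$, consider the random variable $$S_{p,q}=\sup_{t\ge0}\big(X_t^p-A_t^q\big).$$ Then $$S_{p,q}\ \stackrel{\text{(law)}}{=}\ (\mathbf{e}_{p,q})^{\frac{pq}{p-q}},$$ where $\mathbf{e}_{p,q}$ is an exponential random variable with parameter (rate) $$c_{p,q}=\frac1q\int_0^\infty\frac{dz}{z^{1-\frac1q}(1+z)^{\frac1p}}.$$
   Context: All processes are defined on a filtered probability space satisfying the usual conditions; "increasing" means nondecreasing. A nonnegative local submartingale $X$ with decomposition $X_t=N_t+A_t$ is of class $(\Sigma)$ if: (i) $(N_t)$ is a càdlàg local martingale with $N_0=0$; (ii) $(A_t)$ is a continuous adapted increasing process with $A_0=0$; (iii) the measure $(dA_t)$ is carried by the set $\{t: X_t=0\}$. "Only negative jumps" means $X_t-X_{t-}\le 0$ for all $t>0$ (continuous $X$ is allowed). $A_\infty=\lim_{t\to\infty}A_t$. An exponential variable with parameter $c$ satisfies $\mathbb{P}(\mathbf{e}>y)=e^{-cy}$, $y\ge0$. *)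

theory Defs
  imports "HOL-Probability.Probability"
begin

text \<open>Time runs through the reals \<open>t \<ge> 0\<close>: filtrations and processes are indexed by \<^typ>\<open>real\<close>, and
  nothing is required (or used) at negative indices. Only the \<open>\<sigma>\<close>-algebra of the measure
  \<open>F t\<close> matters. Pathwise properties of processes are required almost surely.\<close>

locale usual_filtered_prob_space = prob_space M + complete_measure M
  for M :: "'a measure" +
  fixes F :: "real \<Rightarrow> 'a measure"
  assumes subalgebra: "\<And>t. 0 \<le> t \<Longrightarrow> subalgebra M (F t)"
    and filtration_mono: "\<And>s t. 0 \<le> s \<Longrightarrow> s \<le> t \<Longrightarrow> sets (F s) \<subseteq> sets (F t)"
    and right_continuous: "\<And>t. 0 \<le> t \<Longrightarrow> sets (F t) = (\<Inter>s\<in>{t<..}. sets (F s))"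
    and null_sets_F0: "null_sets M \<subseteq> sets (F 0)"

definition adapted :: "(real \<Rightarrow> 'a measure) \<Rightarrow> (real \<Rightarrow> 'a \<Rightarrow> real) \<Rightarrow> bool" where
  "adapted F X \<longleftrightarrow> (\<forall>t\<ge>0. X t \<in> borel_measurable (F t))"

definition martingale :: "'a measure \<Rightarrow> (real \<Rightarrow> 'a measure) \<Rightarrow> (real \<Rightarrow> 'a \<Rightarrow> real) \<Rightarrow> bool" where
  "martingale M F X \<longleftrightarrow> adapted F X \<and> (\<forall>t\<ge>0. integrable M (X t)) \<and>
     (\<forall>s\<ge>0. \<forall>t\<ge>s. AE \<omega> in M. real_cond_exp M (F s) (X t) \<omega> = X s \<omega>)"

definition submartingale :: "'a measure \<Rightarrow> (real \<Rightarrow> 'a measure) \<Rightarrow> (real \<Rightarrow> 'a \<Rightarrow> real) \<Rightarrow> bool" where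
  "submartingale M F X \<longleftrightarrow> adapted F X \<and> (\<forall>t\<ge>0. integrable M (X t)) \<and>
     (\<forall>s\<ge>0. \<forall>t\<ge>s. AE \<omega> in M. X s \<omega> \<le> real_cond_exp M (F s) (X t) \<omega>)"

text \<open>Stopping times may take the value \<open>\<infinity>\<close>, which is why \<^const>\<open>stopping_time\<close> (values in the index
  type of the filtration) is not used.\<close>

definition ext_stopping_time :: "(real \<Rightarrow> 'a measure) \<Rightarrow> ('a \<Rightarrow> ennreal) \<Rightarrow> bool" where
  "ext_stopping_time F T \<longleftrightarrow> (\<forall>t\<ge>0. Measurable.pred (F t) (\<lambda>\<omega>. T \<omega> \<le> ennreal t))"

definition stopped :: "(real \<Rightarrow> 'a \<Rightarrow> real) \<Rightarrow> ('a \<Rightarrow> ennreal) \<Rightarrow> real \<Rightarrow> 'a \<Rightarrow> real" where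
  "stopped X T t \<omega> = X (enn2real (min (ennreal t) (T \<omega>))) \<omega>"

definition localizing_sequence ::
    "'a measure \<Rightarrow> (real \<Rightarrow> 'a measure) \<Rightarrow> (nat \<Rightarrow> 'a \<Rightarrow> ennreal) \<Rightarrow> bool" where
  "localizing_sequence M F T \<longleftrightarrow> (\<forall>n. ext_stopping_time F (T n)) \<and>
     (AE \<omega> in M. incseq (\<lambda>n. T n \<omega>) \<and> (\<lambda>n. T n \<omega>) \<longlonglongrightarrow> \<infinity>)"

text \<open>For a process with a non-integrable initial value one would localize \<open>X - X\<^sub>0\<close>; below all
  processes start at \<open>0\<close>, so the plain stopped process is the right object.\<close>

definition local_martingale ::
    "'a measure \<Rightarrow> (real \<Rightarrow> 'a measure) \<Rightarrow> (real \<Rightarrow> 'a \<Rightarrow> real) \<Rightarrow> bool" where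
  "local_martingale M F X \<longleftrightarrow> adapted F X \<and>
     (\<exists>T. localizing_sequence M F T \<and> (\<forall>n. martingale M F (stopped X (T n))))"

definition local_submartingale ::
    "'a measure \<Rightarrow> (real \<Rightarrow> 'a measure) \<Rightarrow> (real \<Rightarrow> 'a \<Rightarrow> real) \<Rightarrow> bool" where
  "local_submartingale M F X \<longleftrightarrow> adapted F X \<and>
     (\<exists>T. localizing_sequence M F T \<and> (\<forall>n. submartingale M F (stopped X (T n))))"

definition cadlag_path :: "(real \<Rightarrow> real) \<Rightarrow> bool" where
  "cadlag_path f \<longleftrightarrow> (\<forall>t\<ge>0. continuous (at_right t) f) \<and>
     (\<forall>t>0. \<exists>l. (f \<longlongrightarrow> l) (at_left t))"

text \<open>The Stieltjes measure \<open>dA\<close> of a path on \<open>[0,\<infinity>)\<close>; freezing the path at negative times makes it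
  vanish on \<open>(-\<infinity>,0)\<close> (and at \<open>0\<close>, for continuous paths).\<close>

definition path_measure :: "(real \<Rightarrow> real) \<Rightarrow> real measure" where
  "path_measure a = interval_measure (\<lambda>t. a (max 0 t))"

definition class_Sigma :: "'a measure \<Rightarrow> (real \<Rightarrow> 'a measure) \<Rightarrow> (real \<Rightarrow> 'a \<Rightarrow> real) \<Rightarrow>
    (real \<Rightarrow> 'a \<Rightarrow> real) \<Rightarrow> (real \<Rightarrow> 'a \<Rightarrow> real) \<Rightarrow> bool" where
  "class_Sigma M F X N A \<longleftrightarrow>
     local_submartingale M F X \<and>
     (AE \<omega> in M. \<forall>t\<ge>0. 0 \<le> X t \<omega>) \<and>
     (AE \<omega> in M. \<forall>t\<ge>0. X t \<omega> = N t \<omega> + A t \<omega>) \<and>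
     local_martingale M F N \<and>
     (AE \<omega> in M. cadlag_path (\<lambda>t. N t \<omega>) \<and> N 0 \<omega> = 0) \<and>
     adapted F A \<and>
     (AE \<omega> in M. continuous_on {0..} (\<lambda>t. A t \<omega>) \<and> mono_on {0..} (\<lambda>t. A t \<omega>) \<and> A 0 \<omega> = 0) \<and>
     (AE \<omega> in M. AE t in path_measure (\<lambda>t. A t \<omega>). 0 \<le> t \<longrightarrow> X t \<omega> = 0)"

definition only_negative_jumps :: "'a measure \<Rightarrow> (real \<Rightarrow> 'a \<Rightarrow> real) \<Rightarrow> bool" where
  "only_negative_jumps M X \<longleftrightarrow>
     (AE \<omega> in M. \<forall>t>0. X t \<omega> - Lim (at_left t) (\<lambda>s. X s \<omega>) \<le> 0)"

text \<open>The supremum is taken in the extended reals, so that it is meaningful on every path.\<close>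

definition sup_power_diff ::
    "(real \<Rightarrow> 'a \<Rightarrow> real) \<Rightarrow> (real \<Rightarrow> 'a \<Rightarrow> real) \<Rightarrow> real \<Rightarrow> real \<Rightarrow> 'a \<Rightarrow> ereal" where
  "sup_power_diff X A p q \<omega> = (SUP t\<in>{0..}. ereal (X t \<omega> powr p - A t \<omega> powr q))"

definition rate :: "real \<Rightarrow> real \<Rightarrow> real" where
  "rate p q = 1 / q * (LBINT z:{0<..}. 1 / (z powr (1 - 1 / q) * (1 + z) powr (1 / p)))"

end

theory Submission
  imports Defs
begin

text \<open>Fix \<open>y > 0\<close> and put \<open>\<phi> a = (y + a powr q) powr (1 / p)\<close>, so that the supremum is at most \<open>y\<close> iff
  \<open>X\<close> never exceeds \<open>\<phi> A\<close>. Stop at the first time \<open>\<rho> u\<close> at which \<open>X > \<phi> A\<close> or \<open>A > u\<close>. As \<open>X\<close> has no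
  upward jumps, \<open>N\<close> is bounded up to \<open>\<rho> u\<close> and optional stopping gives \<open>E X (\<rho> u) = E A (\<rho> u)\<close>. At \<open>\<rho> u\<close>
  either \<open>X = \<phi> A\<close>, or \<open>A = u\<close> is about to increase and hence \<open>X = 0\<close> because \<open>dA\<close> is carried by the
  zeros of \<open>X\<close>. If \<open>G u\<close> is the probability of the latter case, comparing the identity at two levels
  yields \<open>G' = - G / \<phi>\<close>, thus \<open>G u = exp (- \<integral>\<^sub>0\<^sup>u da / \<phi> a)\<close>. Let \<open>u \<rightarrow> \<infinity>\<close> and substitute \<open>z = a\<^sup>q / y\<close>.\<close>

section \<open>Paths and their crossing times\<close>

text \<open>The levels of \<open>A\<close> replace time as the parameter. As \<open>A\<close> is
  continuous and unbounded, every level is passed at a finite time, and a path that has not yet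
  crossed the barrier has \<open>A\<close> equal to \<open>u\<close> at \<open>hit u\<close>.
  Between levels \<open>u\<close> and \<open>v\<close> nothing changes on paths that have already
  crossed, a path crossing in between raises \<open>X\<close> from 0 to a value in
  [\<phi> u, \<phi> v], and a surviving path gains v - u in \<open>A\<close>. Monotonicity of \<phi>
  turns this into inequalities for all \<open>u \<le> v\<close>, tight enough to force
  \<open>G\<close> to be differentiable. The obstacle is that a right-continuous path need not lie
  in the crossing set at the crossing time itself, so only events \<open>hit u < s\<close> are
  directly observable, and that \<open>N\<close> is merely a local martingale. The bound on
  \<open>N\<close>, valid up to and including the crossing time, serves both the discretization of
  that time and the removal of the localization. The barrier must stay positive, hence y > 0; the
  level y = 0 is recovered by right-continuity of distribution functions.\<close>

lemma tendsto_at_right_half: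
  fixes f :: "real \<Rightarrow> real"
  assumes "continuous_on {0..} f" "0 \<le> t"
  shows "(f \<longlongrightarrow> f t) (at_right t)"
proof (rule tendsto_within_subset)
  show "(f \<longlongrightarrow> f t) (at t within {0..})"
    using assms by (simp add: continuous_on_def)
qed (use assms in auto)

lemma tendsto_at_left_half:
  fixes f :: "real \<Rightarrow> real"
  assumes "continuous_on {0..} f" "0 < t"
  shows "(f \<longlongrightarrow> f t) (at_left t)"
proof -
  have "isCont f t"
    using assms by (intro continuous_on_interior[of "{0..}"]) auto
  then show ?thesis
    by (simp add: filterlim_at_split isCont_def)
qed

text \<open>One trajectory outside a null set. All crossing arguments are deterministic; probability
  enters later, through expectations only.\<close>

locale sigma_path =
  fixes x a \<phi> :: "real \<Rightarrow> real"
  assumes a_cont: "continuous_on {0..} a" and a_mono: "mono_on {0..} a" and a_0: "a 0 = 0"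
    and a_top: "filterlim a at_top at_top"
    and x_nonneg: "\<And>t. 0 \<le> t \<Longrightarrow> 0 \<le> x t" and x_0: "x 0 = 0"
    and x_right: "\<And>t. 0 \<le> t \<Longrightarrow> continuous (at_right t) x"
    and x_jump: "\<And>t. 0 < t \<Longrightarrow> \<exists>l. (x \<longlongrightarrow> l) (at_left t) \<and> x t \<le> l"
    and x_support: "AE t in path_measure a. 0 \<le> t \<longrightarrow> x t = 0"
    and phi_cont: "continuous_on {0..} \<phi>" and phi_mono: "mono_on {0..} \<phi>"
    and phi_pos: "\<And>u. 0 \<le> u \<Longrightarrow> 0 < \<phi> u"
begin

text \<open>The inequalities are strict so that membership persists for a short while to the right
  of each member. The infimum itself need not be a member.\<close>

definition exceed :: "real \<Rightarrow> real set" where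
  "exceed u = {t. 0 \<le> t \<and> (\<phi> (a t) < x t \<or> u < a t)}"

definition hit :: "real \<Rightarrow> real" where
  "hit u = Inf (exceed u)"

definition safe :: "real \<Rightarrow> bool" where
  "safe u \<longleftrightarrow> (\<forall>t\<ge>0. a t \<le> u \<longrightarrow> x t \<le> \<phi> (a t))"

lemma a_nonneg: "0 \<le> t \<Longrightarrow> 0 \<le> a t"
  using a_mono a_0 by (metis atLeast_iff mono_onD order_refl)

lemma a_le: "0 \<le> s \<Longrightarrow> s \<le> t \<Longrightarrow> a s \<le> a t"
  using a_mono by (meson atLeast_iff mono_onD order_trans)

lemma phi_a_cont: "continuous_on {0..} (\<lambda>t. \<phi> (a t))"
  by (rule continuous_on_compose2[OF phi_cont a_cont]) (auto intro: a_nonneg)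

lemma exceed_nonempty: "exceed u \<noteq> {}"
proof -
  have "\<forall>\<^sub>F t in at_top. u < a t"
    using a_top by (simp add: filterlim_at_top_dense)
  then have "\<forall>\<^sub>F t in at_top. u < a t \<and> 0 \<le> t"
    using eventually_ge_at_top by (rule eventually_conj)
  then obtain t where "u < a t" "0 \<le> t"
    using eventually_happens'[OF trivial_limit_at_top_linorder] by blast
  then show ?thesis
    by (auto simp: exceed_def)
qed

lemma exceed_bdd: "bdd_below (exceed u)"
  by (auto simp: exceed_def intro: bdd_belowI)

lemma hit_nonneg: "0 \<le> hit u"
  unfolding hit_def by (rule cInf_greatest[OF exceed_nonempty]) (auto simp: exceed_def)

lemma hit_le: "t \<in> exceed u \<Longrightarrow> hit u \<le> t"
  unfolding hit_def by (rule cInf_lower[OF _ exceed_bdd])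

lemma hit_less_iff: "hit u < s \<longleftrightarrow> (\<exists>t\<in>exceed u. t < s)"
  unfolding hit_def by (rule cInf_less_iff[OF exceed_nonempty exceed_bdd])

lemma before_hit: "0 \<le> t \<Longrightarrow> t < hit u \<Longrightarrow> x t \<le> \<phi> (a t) \<and> a t \<le> u"
  using hit_le[of t u] by (force simp: exceed_def)

lemma hit_mono: "u \<le> v \<Longrightarrow> hit u \<le> hit v"
  unfolding hit_def
  by (rule cInf_superset_mono[OF exceed_nonempty exceed_bdd]) (auto simp: exceed_def)

text \<open>Before \<open>hit u\<close> both inequalities hold by definition of the infimum. At
  \<open>hit u\<close> they pass to left limits, and \<open>x\<close> cannot jump above its left
  limit. Time 0 has no left limit and is settled by \<open>x_0\<close>.\<close>

lemma until_hit:
  assumes "0 \<le> u" "0 \<le> t" "t \<le> hit u"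
  shows "x t \<le> \<phi> (a t)" "a t \<le> u"
proof -
  have "x t \<le> \<phi> (a t) \<and> a t \<le> u"
  proof (cases "t = 0 \<or> t < hit u")
    case True
    then show ?thesis
      using before_hit[OF assms(2)] a_0 x_0 phi_pos[of 0] assms(1) by auto
  next
    case False
    then have t: "t = hit u" "0 < t"
      using assms by auto
    have ev: "\<forall>\<^sub>F s in at_left t. x s \<le> \<phi> (a s) \<and> a s \<le> u"
      using before_hit[of _ u] t by (intro eventually_at_leftI[of 0]) auto
    obtain l where l: "(x \<longlongrightarrow> l) (at_left t)" "x t \<le> l"
      using x_jump[OF t(2)] by blast
    have "l \<le> \<phi> (a t)"
      by (rule tendsto_le[OF _ tendsto_at_left_half[OF phi_a_cont t(2)] l(1)])
         (use ev in \<open>auto elim: eventually_mono\<close>)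
    moreover have "a t \<le> u"
      by (rule tendsto_upperbound[OF tendsto_at_left_half[OF a_cont t(2)]])
         (use ev in \<open>auto elim: eventually_mono\<close>)
    ultimately show ?thesis
      using l(2) by simp
  qed
  then show "x t \<le> \<phi> (a t)" "a t \<le> u" by auto
qed

lemma until_hit_bound:
  assumes "0 \<le> u" "0 \<le> t" "t \<le> hit u"
  shows "x t \<le> \<phi> u"
  using until_hit[OF assms] phi_mono a_nonneg[OF assms(2)] assms(1)
  by (meson atLeast_iff mono_onD order_trans)

text \<open>If \<open>x r\<close> were nonzero, right-continuity would keep \<open>x\<close> away
  from 0 on some interval \<open>{r<..m}\<close>. The support property makes that interval null for
  the path measure, whereas its mass is \<open>a m - a r > 0\<close>.\<close>

lemma zero_at_right_increase:
  assumes "0 \<le> r" "\<And>t. r < t \<Longrightarrow> a r < a t"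
  shows "x r = 0"
proof (rule ccontr)
  assume "x r \<noteq> 0"
  moreover have "(x \<longlongrightarrow> x r) (at_right r)"
    using x_right[OF assms(1)] by (simp add: continuous_within)
  ultimately have "\<forall>\<^sub>F t in at_right r. x t \<noteq> 0"
    by (rule tendsto_imp_eventually_ne[rotated])
  then obtain b where b: "b > r" "\<And>t. r < t \<Longrightarrow> t < b \<Longrightarrow> x t \<noteq> 0"
    by (auto simp: eventually_at_right_field)
  \<comment> \<open>The midpoint keeps the closed right end of \<open>{r<..m}\<close> inside the
    open interval on which \<open>x\<close> is nonzero.\<close>
  define m where "m = (r + b) / 2"
  have m: "r < m" "m < b"
    using b(1) by (auto simp: m_def)
  have "AE t in path_measure a. t \<notin> {r<..m}"
    using x_support by eventually_elim (use b(2) m assms(1) in force)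
  then have "emeasure (path_measure a) {r<..m} = 0"
    by (subst (asm) AE_iff_measurable[of "{r<..m}"]) (auto simp: path_measure_def)
  moreover have "emeasure (path_measure a) {r<..m} = ennreal (a m - a r)"
  proof -
    have "emeasure (interval_measure (\<lambda>t. a (max 0 t))) {r<..m} = a (max 0 m) - a (max 0 r)"
    proof (rule emeasure_interval_measure_Ioc)
      show "r \<le> m" using m by simp
      show "a (max 0 s) \<le> a (max 0 t)" if "s \<le> t" for s t
        using that by (intro a_le) auto
      have "continuous_on UNIV (\<lambda>t. a (max 0 t))"
        by (rule continuous_on_compose2[OF a_cont]) (auto intro!: continuous_intros)
      then show "continuous (at_right t) (\<lambda>t. a (max 0 t))" for t
        using continuous_at_imp_continuous_at_within continuous_on_eq_continuous_at by blast
    qed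
    then show ?thesis
      using m assms(1) by (simp add: path_measure_def)
  qed
  ultimately show False
    using assms(2)[OF m(1)] by simp
qed

text \<open>On a safe path \<open>exceed u\<close> can be entered only through
  \<open>u < a t\<close>. So \<open>a\<close> exceeds \<open>u\<close> immediately after
  \<open>hit u\<close>, which makes \<open>hit u\<close> a point of right increase.\<close>

lemma safe_hit:
  assumes "0 \<le> u" "safe u"
  shows "a (hit u) = u" "x (hit u) = 0"
proof -
  have late: "u < a t" if "hit u < t" for t
  proof -
    obtain s where "s \<in> exceed u" "s < t"
      using \<open>hit u < t\<close> hit_less_iff by blast
    then show ?thesis
      using assms(2) a_le[of s t] by (fastforce simp: exceed_def safe_def)
  qed
  have "u \<le> a (hit u)"
    by (rule tendsto_lowerbound[OF tendsto_at_right_half[OF a_cont hit_nonneg]])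
       (auto intro!: eventually_at_rightI[of _ "hit u + 1"] less_imp_le late)
  then show eq: "a (hit u) = u"
    using until_hit(2)[OF assms(1) hit_nonneg order_refl] by simp
  show "x (hit u) = 0"
    by (rule zero_at_right_increase[OF hit_nonneg]) (simp add: eq late)
qed

text \<open>Up to a violation \<open>t0\<close> with \<open>a t0 \<le> u\<close>, the clock cannot
  exceed \<open>u\<close>, so members of \<open>exceed u\<close> there are violations of the
  barrier. Such violations do not depend on the level, which is why raising it leaves the crossing
  time unchanged.\<close>

lemma unsafe_hit:
  assumes "0 \<le> u" "\<not> safe u"
  shows "x (hit u) = \<phi> (a (hit u))" and "u \<le> v \<Longrightarrow> hit v = hit u"
proof -
  obtain t0 where t0: "0 \<le> t0" "a t0 \<le> u" "\<phi> (a t0) < x t0"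
    using assms(2) by (auto simp: safe_def)
  have t0_in: "t0 \<in> exceed v" for v
    using t0 by (auto simp: exceed_def)
  have viol: "\<phi> (a t) < x t" if "t \<in> exceed u" "t \<le> t0" for t
    using that a_le[of t t0] t0 by (auto simp: exceed_def)
  show "x (hit u) = \<phi> (a (hit u))"
  proof (rule antisym)
    show "x (hit u) \<le> \<phi> (a (hit u))"
      by (rule until_hit(1)[OF assms(1) hit_nonneg order_refl])
    show "\<phi> (a (hit u)) \<le> x (hit u)"
    \<comment> \<open>If \<open>x\<close> were strictly below the barrier at \<open>hit u\<close>,
      it would stay below for a while by right-continuity, but the infimum forces violations
      arbitrarily soon afterwards.\<close>
    proof (rule ccontr)
      assume neg: "\<not> \<phi> (a (hit u)) \<le> x (hit u)"
      have "((\<lambda>t. \<phi> (a t) - x t) \<longlongrightarrow> \<phi> (a (hit u)) - x (hit u)) (at_right (hit u))"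
        using x_right[OF hit_nonneg] tendsto_at_right_half[OF phi_a_cont hit_nonneg]
        by (intro tendsto_diff) (auto simp: continuous_within)
      then have "\<forall>\<^sub>F t in at_right (hit u). 0 < \<phi> (a t) - x t"
        using neg by (intro order_tendstoD(1)) auto
      then obtain b where b: "b > hit u" "\<And>t. hit u < t \<Longrightarrow> t < b \<Longrightarrow> x t < \<phi> (a t)"
        by (auto simp: eventually_at_right_field)
      have "hit u \<le> t0"
        by (rule hit_le[OF t0_in])
      have "hit u \<noteq> t0"
        using neg t0 by auto
      with \<open>hit u \<le> t0\<close> have "hit u < min b t0"
        using b(1) by auto
      then obtain s where s: "s \<in> exceed u" "s < min b t0"
        using hit_less_iff by blast
      then show False
        using viol[OF s(1)] b(2)[of s] hit_le[OF s(1)] neg by (cases "s = hit u") auto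
    qed
  qed
  show "hit v = hit u" if "u \<le> v"
  proof (rule antisym[OF _ hit_mono[OF that]])
    show "hit v \<le> hit u"
    proof (rule ccontr)
      assume "\<not> hit v \<le> hit u"
      then have "hit u < hit v"
        by simp
      then obtain s where s: "s \<in> exceed u" "s < hit v"
        using hit_less_iff by blast
      have "s \<le> t0"
        using hit_le[OF t0_in, of v] s(2) by simp
      then have "s \<in> exceed v"
        using viol[OF s(1)] s(1) by (auto simp: exceed_def)
      then show False
        using hit_le s(2) by fastforce
    qed
  qed
qed

lemma safe_antimono: "u \<le> v \<Longrightarrow> safe v \<Longrightarrow> safe u"
  by (auto simp: safe_def)

text \<open>At \<open>hit u\<close> an unsafe path sits on the barrier, which is positive, and a
  safe one at 0. Thus safety can be read off from a random variable, which gives its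
  measurability.\<close>

lemma safe_iff_hit: "0 \<le> u \<Longrightarrow> safe u \<longleftrightarrow> x (hit u) = 0"
  using safe_hit unsafe_hit(1) phi_pos[OF a_nonneg[OF hit_nonneg]] by (metis less_irrefl)

text \<open>Right-continuity lets a rational time slightly to the right replace any witness, so
  \<open>hit u < s\<close> involves only countably many times before \<open>s\<close>.\<close>

lemma hit_less_iff_rat:
  "hit u < s \<longleftrightarrow> (\<exists>t. 0 \<le> t \<and> t < s \<and> t \<in> \<rat> \<and> (\<phi> (a t) < x t \<or> u < a t))"
proof
  assume "hit u < s"
  then obtain t where t: "t \<in> exceed u" "t < s"
    using hit_less_iff by blast
  then have "0 \<le> t" by (simp add: exceed_def)
  have "\<forall>\<^sub>F r in at_right t. \<phi> (a r) < x r \<or> u < a r"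
    using t(1) unfolding exceed_def
  proof (clarsimp, elim disjE)
    assume "\<phi> (a t) < x t"
    moreover have "((\<lambda>t. x t - \<phi> (a t)) \<longlongrightarrow> x t - \<phi> (a t)) (at_right t)"
      using x_right[OF \<open>0 \<le> t\<close>] tendsto_at_right_half[OF phi_a_cont \<open>0 \<le> t\<close>]
      by (intro tendsto_diff) (auto simp: continuous_within)
    ultimately have "\<forall>\<^sub>F r in at_right t. 0 < x r - \<phi> (a r)"
      by (intro order_tendstoD(1)) auto
    then show ?thesis by eventually_elim auto
  next
    assume "u < a t"
    then have "\<forall>\<^sub>F r in at_right t. u < a r"
      by (intro order_tendstoD(1)[OF tendsto_at_right_half[OF a_cont \<open>0 \<le> t\<close>]])
    then show ?thesis by eventually_elim auto
  qed
  then obtain b where b: "b > t" "\<And>r. t < r \<Longrightarrow> r < b \<Longrightarrow> \<phi> (a r) < x r \<or> u < a r"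
    by (auto simp: eventually_at_right_field)
  obtain r where "r \<in> \<rat>" "t < r" "r < min b s"
    using Rats_dense_in_real[of t "min b s"] b(1) t(2) by auto
  then show "\<exists>t. 0 \<le> t \<and> t < s \<and> t \<in> \<rat> \<and> (\<phi> (a t) < x t \<or> u < a t)"
    using b(2)[of r] \<open>0 \<le> t\<close> by (intro exI[of _ r]) auto
qed (auto simp: hit_less_iff exceed_def)

end

text \<open>Three cases: crossed by level \<open>u\<close> (nothing moves), crossed between the
  levels (\<open>x\<close> climbs from 0 to \<phi> at some clock value in [u, v]), or safe at
  \<open>v\<close> (\<open>x\<close> is 0 at both times and \<open>a\<close> gains
  \<open>v - u\<close>). Taking expectations of these four bounds yields the inequalities for the
  survival probability.\<close>

lemma (in sigma_path) hit_increments: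
  assumes "0 \<le> u" "u \<le> v"
  shows "\<phi> u * (of_bool (safe u) - of_bool (safe v)) \<le> x (hit v) - x (hit u)"
    and "x (hit v) - x (hit u) \<le> \<phi> v * (of_bool (safe u) - of_bool (safe v))"
    and "(v - u) * of_bool (safe v) \<le> a (hit v) - a (hit u)"
    and "a (hit v) - a (hit u) \<le> (v - u) * of_bool (safe u)"
proof -
  have v: "0 \<le> v" using assms by simp
  have "\<phi> u * (of_bool (safe u) - of_bool (safe v)) \<le> x (hit v) - x (hit u) \<and>
    x (hit v) - x (hit u) \<le> \<phi> v * (of_bool (safe u) - of_bool (safe v)) \<and>
    (v - u) * of_bool (safe v) \<le> a (hit v) - a (hit u) \<and>
    a (hit v) - a (hit u) \<le> (v - u) * of_bool (safe u)"
  proof (cases "safe u")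
    case True
    note su = True safe_hit[OF assms(1) True]
    show ?thesis
    proof (cases "safe v")
      case True
      then show ?thesis
        using su safe_hit[OF v True] by simp
    next
      case False
      have "u \<le> a (hit v)" "a (hit v) \<le> v"
        using su a_le[OF hit_nonneg hit_mono[OF assms(2)]] until_hit(2)[OF v hit_nonneg order_refl] by auto
      moreover have "x (hit v) = \<phi> (a (hit v))"
        by (rule unsafe_hit(1)[OF v False])
      moreover have "\<phi> u \<le> \<phi> (a (hit v))" "\<phi> (a (hit v)) \<le> \<phi> v"
        using calculation assms by (auto intro!: mono_onD[OF phi_mono])
      ultimately show ?thesis
        using su False by simp
    qed
  next
    case False
    then show ?thesis
      using unsafe_hit(2)[OF assms(1) False assms(2)] safe_antimono[OF assms(2)] by auto
  qed
  then show "\<phi> u * (of_bool (safe u) - of_bool (safe v)) \<le> x (hit v) - x (hit u)"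
    "x (hit v) - x (hit u) \<le> \<phi> v * (of_bool (safe u) - of_bool (safe v))"
    "(v - u) * of_bool (safe v) \<le> a (hit v) - a (hit u)"
    "a (hit v) - a (hit u) \<le> (v - u) * of_bool (safe u)" by auto
qed

section \<open>Optional stopping\<close>

lemma (in complete_measure) measurable_AE_cong:
  assumes f: "f \<in> M \<rightarrow>\<^sub>M borel" and eq: "AE \<omega> in M. f \<omega> = g \<omega>"
  shows "g \<in> M \<rightarrow>\<^sub>M (borel :: 'b :: topological_space measure)"
proof (rule measurableI)
  fix B :: "'b set" assume "B \<in> sets borel"
  then have "f -` B \<inter> space M \<in> sets M"
    using measurable_sets[OF f] by blast
  then show "g -` B \<inter> space M \<in> sets M"
    by (rule in_sets_AE[rotated]) (use eq in auto)
qed simp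

lemma (in complete_measure) borel_measurable_LIMSEQ_AE:
  fixes f :: "nat \<Rightarrow> 'a \<Rightarrow> real"
  assumes f [measurable]: "\<And>i. f i \<in> borel_measurable M"
    and lim: "AE \<omega> in M. (\<lambda>i. f i \<omega>) \<longlonglongrightarrow> g \<omega>"
  shows "g \<in> borel_measurable M"
proof -
  \<comment> \<open>Replacing all functions by 0 on the exceptional null set makes the convergence
    hold everywhere.\<close>
  define Z where "Z = {\<omega>\<in>space M. \<not> (\<lambda>i. f i \<omega>) \<longlonglongrightarrow> g \<omega>}"
  have Z [measurable]: "Z \<in> sets M"
    using lim unfolding AE_iff_null_sets Z_def by auto
  have "(\<lambda>\<omega>. if \<omega> \<in> Z then 0 else g \<omega>) \<in> borel_measurable M"
  proof (rule borel_measurable_LIMSEQ_real)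
    show "(\<lambda>i. if \<omega> \<in> Z then 0 else f i \<omega>) \<longlonglongrightarrow> (if \<omega> \<in> Z then 0 else g \<omega>)" if "\<omega> \<in> space M" for \<omega>
      using that by (auto simp: Z_def)
  qed measurable
  moreover have "AE \<omega> in M. (if \<omega> \<in> Z then 0 else g \<omega>) = g \<omega>"
    using lim by eventually_elim (auto simp: Z_def)
  ultimately show ?thesis
    by (rule measurable_AE_cong)
qed

text \<open>The first point of the grid with mesh \<open>1 / Suc k\<close> strictly after \<open>r\<close>: strictness lets right-continuity
  of paths apply, and only events \<open>\<rho> < s\<close> are needed to decide its value at \<open>\<rho>\<close>.\<close>

definition next_grid :: "nat \<Rightarrow> real \<Rightarrow> real" where
  "next_grid k r = (of_int \<lfloor>r * real (Suc k)\<rfloor> + 1) / real (Suc k)"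

lemma next_grid_gt: "r < next_grid k r"
  unfolding next_grid_def by (simp add: field_simps) linarith

lemma next_grid_le: "next_grid k r \<le> r + 1 / Suc k"
proof -
  have "next_grid k r \<le> (r * real (Suc k) + 1) / real (Suc k)"
    unfolding next_grid_def by (intro divide_right_mono) auto
  then show ?thesis
    by (simp add: add_divide_distrib del: of_nat_Suc)
qed

lemma next_grid_tendsto: "(\<lambda>k. next_grid k r) \<longlonglongrightarrow> r"
proof (rule tendsto_sandwich[of "\<lambda>_. r" _ _ "\<lambda>k. r + 1 / Suc k"])
  show "(\<lambda>k. r + 1 / real (Suc k)) \<longlonglongrightarrow> r"
    using LIMSEQ_inverse_real_of_nat_add[of r] by (simp add: field_simps)
qed (use next_grid_le less_imp_le[OF next_grid_gt] in auto)

lemma next_grid_eq_iff: "next_grid k r = real j / Suc k \<longleftrightarrow> (real j - 1) / Suc k \<le> r \<and> r < real j / Suc k"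
proof -
  have "next_grid k r = real j / Suc k \<longleftrightarrow> \<lfloor>r * Suc k\<rfloor> = int j - 1"
    unfolding next_grid_def by (simp add: divide_simps del: of_nat_Suc) linarith
  also have "\<dots> \<longleftrightarrow> (real j - 1) / Suc k \<le> r \<and> r < real j / Suc k"
    unfolding floor_eq_iff by (simp add: field_simps del: of_nat_Suc)
  finally show ?thesis .
qed

lemma next_grid_ge_iff: "real m \<le> next_grid k r \<longleftrightarrow> (real (m * Suc k) - 1) / Suc k \<le> r"
proof -
  have "real m \<le> next_grid k r \<longleftrightarrow> real (m * Suc k) \<le> of_int \<lfloor>r * Suc k\<rfloor> + 1"
    unfolding next_grid_def by (simp only: pos_le_divide_eq of_nat_mult of_nat_0_less_iff zero_less_Suc)
  also have "\<dots> \<longleftrightarrow> int (m * Suc k) - 1 \<le> \<lfloor>r * Suc k\<rfloor>"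
    by linarith
  also have "\<dots> \<longleftrightarrow> (real (m * Suc k) - 1) / Suc k \<le> r"
    by (simp only: le_floor_iff pos_divide_le_eq of_nat_0_less_iff zero_less_Suc) simp
  finally show ?thesis .
qed

lemma next_grid_range:
  assumes "0 \<le> r"
  obtains j where "1 \<le> j" "next_grid k r = real j / Suc k"
proof
  show "1 \<le> nat \<lfloor>r * Suc k\<rfloor> + 1" by simp
  show "next_grid k r = real (nat \<lfloor>r * Suc k\<rfloor> + 1) / Suc k"
  proof -
    have "0 \<le> \<lfloor>r * Suc k\<rfloor>" using assms by simp
    then show ?thesis unfolding next_grid_def by simp
  qed
qed

lemma grid_end: "real (m * Suc k) / real (Suc k) = real m"
  by (subst of_nat_mult) (rule nonzero_mult_div_cancel_right, simp)

text \<open>Only comparisons of the form \<open>r < s\<close> occur on the right, the events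
  available for a crossing time. The last index \<open>m * Suc k\<close> absorbs everything beyond
  the cap, so it carries no upper comparison.\<close>

lemma min_next_grid_eq_iff:
  assumes "j \<le> m * Suc k"
  shows "min (real m) (next_grid k r) = real j / Suc k \<longleftrightarrow>
    (j = m * Suc k \<or> r < real j / Suc k) \<and> \<not> r < (real j - 1) / Suc k"
proof (cases "j = m * Suc k")
  case True
  then have "real m = real j / Suc k"
    using grid_end by metis
  then have "min (real m) (next_grid k r) = real j / Suc k \<longleftrightarrow> real m \<le> next_grid k r"
    by (simp add: min_def)
  then show ?thesis
    using True unfolding next_grid_ge_iff by auto
next
  case False
  then have "real j < real (m * Suc k)"
    using assms by (simp only: of_nat_less_iff le_neq_implies_less)
  then have "real j / Suc k < real m"
    using divide_strict_right_mono[of "real j" "real (m * Suc k)" "real (Suc k)"] grid_end[of m k] by simp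
  then have "min (real m) (next_grid k r) = real j / Suc k \<longleftrightarrow> next_grid k r = real j / Suc k"
    by (auto simp: min_def)
  then show ?thesis
    using False unfolding next_grid_eq_iff by auto
qed

lemma right_cont_next_grid:
  fixes f :: "real \<Rightarrow> real"
  assumes "0 \<le> r" "continuous (at_right r) f"
  shows "(\<lambda>k. f (next_grid k r)) \<longlonglongrightarrow> f r"
proof -
  have "filterlim (\<lambda>k. next_grid k r) (at_right r) sequentially"
    unfolding filterlim_at using next_grid_tendsto[of r] next_grid_gt[of r]
    by (auto intro!: always_eventually simp: less_imp_neq[symmetric] less_le)
  moreover have "(f \<longlongrightarrow> f r) (at_right r)"
    using assms by (simp add: continuous_within)
  ultimately show ?thesis
    by (rule filterlim_compose[rotated])
qed

text \<open>If \<open>m \<le> r\<close> the cap makes the sequence constant, since grid points lie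
  beyond \<open>r\<close>; otherwise the cap is eventually inactive.\<close>

lemma right_cont_min_next_grid:
  fixes f :: "real \<Rightarrow> real"
  assumes "0 \<le> r" "\<And>t. 0 \<le> t \<Longrightarrow> continuous (at_right t) f"
  shows "(\<lambda>k. f (min (real m) (next_grid k r))) \<longlonglongrightarrow> f (min (real m) r)"
proof (cases "real m \<le> r")
  case True
  then have "min (real m) (next_grid k r) = real m" for k
    using next_grid_gt[of r k] by simp
  then show ?thesis
    using True by simp
next
  case False
  have "\<forall>\<^sub>F k in sequentially. next_grid k r < real m"
    using order_tendstoD(2)[OF next_grid_tendsto] False by simp
  then have "\<forall>\<^sub>F k in sequentially. f (next_grid k r) = f (min (real m) (next_grid k r))"
    by eventually_elim simp
  then have "(\<lambda>k. f (min (real m) (next_grid k r))) \<longlonglongrightarrow> f r"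
    by (rule Lim_transform_eventually[OF right_cont_next_grid[OF assms(1) assms(2)[OF assms(1)]]])
  then show ?thesis
    using False by simp
qed

section \<open>Filtrations, random times and bounded optional stopping\<close>

context usual_filtered_prob_space
begin

lemma finite_measure_subalgebra: "0 \<le> t \<Longrightarrow> finite_measure_subalgebra M (F t)"
  using subalgebra by unfold_locales auto

lemma space_F: "0 \<le> t \<Longrightarrow> space (F t) = space M"
  using subalgebra by (auto simp: subalgebra_def)

lemma measurable_F_mono:
  "0 \<le> s \<Longrightarrow> s \<le> t \<Longrightarrow> f \<in> F s \<rightarrow>\<^sub>M N \<Longrightarrow> f \<in> F t \<rightarrow>\<^sub>M N"
  by (rule measurable_from_subalg) (use filtration_mono space_F in \<open>auto simp: subalgebra_def\<close>)

lemma measurable_F_imp_M: "0 \<le> t \<Longrightarrow> f \<in> F t \<rightarrow>\<^sub>M N \<Longrightarrow> f \<in> M \<rightarrow>\<^sub>M N"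
  by (rule measurable_from_subalg[OF subalgebra])

text \<open>The sets differ by null sets, which already lie in \<open>F 0\<close>. This transfers
  adaptedness to crossing times, whose countable description is valid only almost surely.\<close>

lemma sets_F_AE:
  assumes "0 \<le> t" "B \<in> sets (F t)" "C \<subseteq> space M" "AE \<omega> in M. \<omega> \<in> B \<longleftrightarrow> \<omega> \<in> C"
  shows "C \<in> sets (F t)"
proof -
  have "B \<subseteq> space M"
    using assms(2) space_F[OF assms(1)] sets.sets_into_space by blast
  moreover have "AE \<omega> in M. \<omega> \<notin> B - C" "AE \<omega> in M. \<omega> \<notin> C - B"
    using assms(4) by (eventually_elim, simp)+
  ultimately have "B - C \<in> null_sets M" "C - B \<in> null_sets M"
    using assms(3) by (auto simp: null_sets_iff_AE)
  then have "B - C \<in> sets (F t)" "C - B \<in> sets (F t)"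
    using null_sets_F0 filtration_mono[of 0 t] assms(1) by auto
  then have "(B - (B - C)) \<union> (C - B) \<in> sets (F t)"
    using assms(2) by auto
  also have "(B - (B - C)) \<union> (C - B) = C"
    by auto
  finally show ?thesis .
qed

lemma martingale_integral_on:
  assumes "martingale M F Y" "0 \<le> s" "s \<le> t" "C \<in> sets (F s)"
  shows "(\<integral>\<omega>. indicator C \<omega> * Y s \<omega> \<partial>M) = (\<integral>\<omega>. indicator C \<omega> * Y t \<omega> \<partial>M)"
proof -
  interpret S: finite_measure_subalgebra M "F s"
    by (rule finite_measure_subalgebra[OF assms(2)])
  have Y: "integrable M (Y t)" "integrable M (Y s)" "AE \<omega> in M. real_cond_exp M (F s) (Y t) \<omega> = Y s \<omega>"
    using assms by (auto simp: martingale_def)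
  have [measurable]: "C \<in> sets M"
    using assms(4) S.subalg by (auto simp: subalgebra_def)
  have [measurable]: "Y s \<in> borel_measurable M" "real_cond_exp M (F s) (Y t) \<in> borel_measurable M"
    using Y(2) S.real_cond_exp_int(1)[OF Y(1)] by auto
  have "(\<integral>\<omega>\<in>C. Y t \<omega> \<partial>M) = (\<integral>\<omega>\<in>C. real_cond_exp M (F s) (Y t) \<omega> \<partial>M)"
    by (rule S.real_cond_exp_intA[OF Y(1) assms(4)])
  also have "\<dots> = (\<integral>\<omega>\<in>C. Y s \<omega> \<partial>M)"
    unfolding set_lebesgue_integral_def
    by (rule integral_cong_AE) (use Y(3) in \<open>auto elim: eventually_mono\<close>)
  finally show ?thesis
    by (simp add: set_lebesgue_integral_def)
qed

lemma measurable_pred_less_imp_measurable: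
  assumes "\<And>\<omega>. 0 \<le> \<rho> \<omega>" "\<And>s. 0 < s \<Longrightarrow> Measurable.pred (F s) (\<lambda>\<omega>. \<rho> \<omega> < s)"
  shows "\<rho> \<in> borel_measurable M"
  unfolding borel_measurable_iff_less
proof
  fix s
  show "{\<omega> \<in> space M. \<rho> \<omega> < s} \<in> sets M"
  proof (cases "0 < s")
    case True
    then show ?thesis
      using measurable_F_imp_M[OF _ assms(2)[OF True]] by (simp add: pred_def)
  next
    case False
    then have "\<not> \<rho> \<omega> < s" for \<omega>
      using assms(1)[of \<omega>] by linarith
    then show ?thesis by simp
  qed
qed

text \<open>A discretized time takes countably many values, so evaluation there is measurable;
  right-continuity carries this to the limit along the grids.\<close>

lemma evaluation_at_random_time_measurable:
  fixes Y :: "real \<Rightarrow> 'a \<Rightarrow> real"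
  assumes Y: "\<And>t. 0 \<le> t \<Longrightarrow> Y t \<in> borel_measurable M"
    and right: "AE \<omega> in M. \<forall>t\<ge>0. continuous (at_right t) (\<lambda>t. Y t \<omega>)"
    and \<rho> [measurable]: "\<rho> \<in> borel_measurable M" and nonneg: "\<And>\<omega>. 0 \<le> \<rho> \<omega>"
  shows "(\<lambda>\<omega>. Y (\<rho> \<omega>) \<omega>) \<in> borel_measurable M"
proof (rule borel_measurable_LIMSEQ_AE[where f = "\<lambda>k \<omega>. Y (next_grid k (\<rho> \<omega>)) \<omega>"])
  show "AE \<omega> in M. (\<lambda>k. Y (next_grid k (\<rho> \<omega>)) \<omega>) \<longlonglongrightarrow> Y (\<rho> \<omega>) \<omega>"
    using right by eventually_elim (auto intro!: right_cont_next_grid nonneg)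
  fix k
  \<comment> \<open>Every integer index needs an admissible time, hence \<open>max 0\<close>. It is
    inactive at the values attained, because grid points after a nonnegative time are
    positive.\<close>
  have "(\<lambda>\<omega>. (\<lambda>j \<omega>. Y (max 0 ((of_int j + 1) / Suc k)) \<omega>) \<lfloor>\<rho> \<omega> * Suc k\<rfloor> \<omega>) \<in> borel_measurable M"
    by (rule measurable_compose_countable) (auto intro!: Y)
  also have "(\<lambda>\<omega>. (\<lambda>j \<omega>. Y (max 0 ((of_int j + 1) / Suc k)) \<omega>) \<lfloor>\<rho> \<omega> * Suc k\<rfloor> \<omega>)
      = (\<lambda>\<omega>. Y (next_grid k (\<rho> \<omega>)) \<omega>)"
  proof
    fix \<omega>
    have "0 \<le> next_grid k (\<rho> \<omega>)"
      using next_grid_gt[of "\<rho> \<omega>" k] nonneg[of \<omega>] by simp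
    then show "Y (max 0 ((of_int \<lfloor>\<rho> \<omega> * Suc k\<rfloor> + 1) / Suc k)) \<omega> = Y (next_grid k (\<rho> \<omega>)) \<omega>"
      by (simp add: next_grid_def del: of_nat_Suc)
  qed
  finally show "(\<lambda>\<omega>. Y (next_grid k (\<rho> \<omega>)) \<omega>) \<in> borel_measurable M" .
qed

text \<open>Truncating on \<open>\<bar>Y\<bar> \<le> c + 1\<close> along the approximating stopping times, which is an event of
  their \<open>\<sigma>\<close>-algebras and is asymptotically sure, replaces the usual appeal to uniform integrability.\<close>

lemma optional_stopping_bounded:
  assumes Y: "martingale M F Y"
    and right: "AE \<omega> in M. \<forall>t\<ge>0. continuous (at_right t) (\<lambda>t. Y t \<omega>)"
    and nonneg: "\<And>\<omega>. 0 \<le> \<rho> \<omega>"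
    and stop: "\<And>s. 0 < s \<Longrightarrow> Measurable.pred (F s) (\<lambda>\<omega>. \<rho> \<omega> < s)"
    and bound: "AE \<omega> in M. \<bar>Y (min (real m) (\<rho> \<omega>)) \<omega>\<bar> \<le> c"
  shows "(\<integral>\<omega>. Y (min (real m) (\<rho> \<omega>)) \<omega> \<partial>M) = (\<integral>\<omega>. Y (real m) \<omega> \<partial>M)"
proof -
  have \<rho> [measurable]: "\<rho> \<in> borel_measurable M"
    by (rule measurable_pred_less_imp_measurable[OF nonneg stop])
  have int: "integrable M (Y t)" if "0 \<le> t" for t
    using Y that by (auto simp: martingale_def)
  then have Y_meas: "Y t \<in> borel_measurable M" if "0 \<le> t" for t
    using that by auto
  have Y_F: "Y t \<in> borel_measurable (F t)" if "0 \<le> t" for t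
    using Y that by (auto simp: martingale_def adapted_def)
  define \<tau> where "\<tau> k \<omega> = min (real m) (next_grid k (\<rho> \<omega>))" for k \<omega>
  have \<tau>_nonneg: "0 \<le> \<tau> k \<omega>" for k \<omega>
    using next_grid_gt[of "\<rho> \<omega>" k] nonneg[of \<omega>] by (simp add: \<tau>_def)
  have [measurable]: "\<tau> k \<in> borel_measurable M" for k
    unfolding \<tau>_def next_grid_def by measurable
  have Y_\<tau> [measurable]: "(\<lambda>\<omega>. Y (\<tau> k \<omega>) \<omega>) \<in> borel_measurable M" for k
    by (rule evaluation_at_random_time_measurable[OF Y_meas right _ \<tau>_nonneg]) auto
  have Y_\<rho> [measurable]: "(\<lambda>\<omega>. Y (min (real m) (\<rho> \<omega>)) \<omega>) \<in> borel_measurable M"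
    by (rule evaluation_at_random_time_measurable[OF Y_meas right]) (auto intro: nonneg)
  have lim: "AE \<omega> in M. (\<lambda>k. Y (\<tau> k \<omega>) \<omega>) \<longlonglongrightarrow> Y (min (real m) (\<rho> \<omega>)) \<omega>"
    using right
  proof eventually_elim
    case (elim \<omega>)
    then show ?case
      unfolding \<tau>_def by (intro right_cont_min_next_grid nonneg) auto
  qed
  define B where "B k = {\<omega>\<in>space M. \<bar>Y (\<tau> k \<omega>) \<omega>\<bar> \<le> c + 1}" for k
  have B [measurable]: "B k \<in> sets M" for k
    unfolding B_def by measurable
  have ev_B: "AE \<omega> in M. \<forall>\<^sub>F k in sequentially. \<omega> \<in> B k"
    using lim bound AE_space
  proof eventually_elim
    case (elim \<omega>)
    have "(\<lambda>k. \<bar>Y (\<tau> k \<omega>) \<omega>\<bar>) \<longlonglongrightarrow> \<bar>Y (min (real m) (\<rho> \<omega>)) \<omega>\<bar>"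
      using elim(1) by (rule tendsto_rabs)
    then have "\<forall>\<^sub>F k in sequentially. \<bar>Y (\<tau> k \<omega>) \<omega>\<bar> < c + 1"
      using elim(2) by (intro order_tendstoD(2)) auto
    then show ?case
      by eventually_elim (use elim(3) in \<open>auto simp: B_def\<close>)
  qed
  have eq: "(\<integral>\<omega>. indicator (B k) \<omega> * Y (\<tau> k \<omega>) \<omega> \<partial>M) = (\<integral>\<omega>. indicator (B k) \<omega> * Y (real m) \<omega> \<partial>M)"
    if "0 < m" for k
  proof -
    \<comment> \<open>Index 0 is excluded: the grid point lies strictly after \<rho> and the cap
      \<open>m\<close> is positive.\<close>
    let ?J = "{1..m * Suc k}"
    let ?s = "\<lambda>j. real j / Suc k"
    \<comment> \<open>\<open>C j\<close> is the part of \<open>B k\<close> on which the discretized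
      time equals \<open>?s j\<close>. It is decided at that time, so the martingale property may
      replace \<open>Y (?s j)\<close> by \<open>Y (real m)\<close> on it.\<close>
    define C where "C j = {\<omega>\<in>space M. \<tau> k \<omega> = ?s j \<and> \<bar>Y (?s j) \<omega>\<bar> \<le> c + 1}" for j
    have C_F: "C j \<in> sets (F (?s j))" if j: "j \<in> ?J" for j
    proof -
      have s: "0 < ?s j" using j by simp
      have [measurable]: "Measurable.pred (F (?s j)) (\<lambda>\<omega>. \<rho> \<omega> < ?s j)"
        by (rule stop[OF s])
      have [measurable]: "Measurable.pred (F (?s j)) (\<lambda>\<omega>. \<rho> \<omega> < (real j - 1) / Suc k)"
      \<comment> \<open>For \<open>j = 1\<close> the preceding grid point is 0, where
        \<open>stop\<close> says nothing, but nonnegativity makes the event empty.\<close>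
      proof (cases "j = 1")
        case True
        have "\<not> \<rho> \<omega> < 0" for \<omega>
          using nonneg[of \<omega>] by simp
        with True show ?thesis
          by simp
      next
        case False
        then have "0 < (real j - 1) / Suc k" using j by simp
        then show ?thesis
          by (intro measurable_F_mono[OF _ _ stop]) (auto simp: divide_right_mono)
      qed
      have [measurable]: "Y (?s j) \<in> borel_measurable (F (?s j))"
        by (rule Y_F) simp
      have "C j = {\<omega>\<in>space (F (?s j)). ((j = m * Suc k \<or> \<rho> \<omega> < ?s j) \<and> \<not> \<rho> \<omega> < (real j - 1) / Suc k)
          \<and> \<bar>Y (?s j) \<omega>\<bar> \<le> c + 1}"
        using j unfolding C_def \<tau>_def by (subst min_next_grid_eq_iff) (auto simp: space_F)
      also have "\<dots> \<in> sets (F (?s j))"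
        by measurable
      finally show ?thesis .
    qed
    then have [measurable]: "C j \<in> sets M" if "j \<in> ?J" for j
      using that subalgebra[of "?s j"] by (auto simp: subalgebra_def)
    have part: "indicator (B k) \<omega> * f (\<tau> k \<omega>) = (\<Sum>j\<in>?J. indicator (C j) \<omega> * f (?s j))"
      if "\<omega> \<in> space M" for \<omega> and f :: "real \<Rightarrow> real"
    proof -
      obtain i where i: "1 \<le> i" "next_grid k (\<rho> \<omega>) = ?s i"
        using next_grid_range[OF nonneg] by blast
      define j where "j = min i (m * Suc k)"
      have j: "j \<in> ?J"
        using i \<open>0 < m\<close> by (auto simp: j_def)
      have \<tau>: "\<tau> k \<omega> = ?s j"
      proof -
        have "mono ?s" by (auto intro!: monoI divide_right_mono)
        then have "min (?s i) (?s (m * Suc k)) = ?s j"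
          unfolding j_def by (rule min_of_mono)
        then show ?thesis
          unfolding \<tau>_def i grid_end by (simp only: min.commute)
      qed
      have "(\<Sum>j'\<in>?J. indicator (C j') \<omega> * f (?s j')) = (\<Sum>j'\<in>?J. if j' = j then indicator (B k) \<omega> * f (?s j) else 0)"
      proof (intro sum.cong refl)
        fix j'
        have "?s j = ?s j' \<longleftrightarrow> j' = j"
          by (auto simp del: of_nat_Suc)
        then show "indicator (C j') \<omega> * f (?s j') = (if j' = j then indicator (B k) \<omega> * f (?s j) else 0)"
          using that by (simp add: C_def B_def \<tau> indicator_def del: of_nat_Suc)
      qed
      then show ?thesis
        using j by (simp add: \<tau>)
    qed
    have intC: "integrable M (\<lambda>\<omega>. indicator (C j) \<omega> * Y t \<omega>)" if "j \<in> ?J" "0 \<le> t" for j t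
      using integrable_mult_indicator[OF _ int[OF that(2)], of "C j"] that(1) by simp
    have "(\<integral>\<omega>. indicator (B k) \<omega> * Y (\<tau> k \<omega>) \<omega> \<partial>M) = (\<integral>\<omega>. (\<Sum>j\<in>?J. indicator (C j) \<omega> * Y (?s j) \<omega>) \<partial>M)"
    proof (rule Bochner_Integration.integral_cong[OF refl])
      fix \<omega> assume "\<omega> \<in> space M"
      from part[OF this, of "\<lambda>t. Y t \<omega>"]
      show "indicator (B k) \<omega> * Y (\<tau> k \<omega>) \<omega> = (\<Sum>j\<in>?J. indicator (C j) \<omega> * Y (?s j) \<omega>)" .
    qed
    also have "\<dots> = (\<Sum>j\<in>?J. \<integral>\<omega>. indicator (C j) \<omega> * Y (?s j) \<omega> \<partial>M)"
      by (rule Bochner_Integration.integral_sum, rule intC) simp_all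
    also have "\<dots> = (\<Sum>j\<in>?J. \<integral>\<omega>. indicator (C j) \<omega> * Y (real m) \<omega> \<partial>M)"
    proof (rule sum.cong)
      fix j assume j: "j \<in> ?J"
      then have "real j \<le> real (m * Suc k)"
        by (simp only: atLeastAtMost_iff of_nat_le_iff)
      then have "?s j \<le> real m"
        using divide_right_mono[of "real j" "real (m * Suc k)" "real (Suc k)"] grid_end[of m k] by simp
      then show "(\<integral>\<omega>. indicator (C j) \<omega> * Y (?s j) \<omega> \<partial>M) = (\<integral>\<omega>. indicator (C j) \<omega> * Y (real m) \<omega> \<partial>M)"
        by (intro martingale_integral_on[OF Y _ _ C_F[OF j]]) simp
    qed simp
    also have "\<dots> = (\<integral>\<omega>. (\<Sum>j\<in>?J. indicator (C j) \<omega> * Y (real m) \<omega>) \<partial>M)"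
      by (subst Bochner_Integration.integral_sum) (rule intC, simp_all)
    also have "\<dots> = (\<integral>\<omega>. indicator (B k) \<omega> * Y (real m) \<omega> \<partial>M)"
    proof (rule Bochner_Integration.integral_cong[OF refl])
      fix \<omega> assume "\<omega> \<in> space M"
      from part[OF this, of "\<lambda>_. Y (real m) \<omega>"]
      show "(\<Sum>j\<in>?J. indicator (C j) \<omega> * Y (real m) \<omega>) = indicator (B k) \<omega> * Y (real m) \<omega>"
        by (rule sym)
    qed
    finally show ?thesis .
  qed
  have [measurable]: "Y (real m) \<in> borel_measurable M"
    by (rule Y_meas) simp
  show ?thesis
  proof (cases "m = 0")
    case True
    then show ?thesis
      using nonneg by (simp add: min_def)
  next
    case False
    have "(\<lambda>k. \<integral>\<omega>. indicator (B k) \<omega> * Y (\<tau> k \<omega>) \<omega> \<partial>M) \<longlonglongrightarrow> (\<integral>\<omega>. Y (min (real m) (\<rho> \<omega>)) \<omega> \<partial>M)"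
    proof (rule integral_dominated_convergence[where w = "\<lambda>_. \<bar>c + 1\<bar>"])
      show "AE \<omega> in M. (\<lambda>k. indicator (B k) \<omega> * Y (\<tau> k \<omega>) \<omega>) \<longlonglongrightarrow> Y (min (real m) (\<rho> \<omega>)) \<omega>"
        using lim ev_B
      proof eventually_elim
        case (elim \<omega>)
        show ?case
          by (rule Lim_transform_eventually[OF elim(1)])
             (use elim(2) in \<open>auto elim: eventually_mono simp: indicator_def\<close>)
      qed
    qed (auto simp: B_def indicator_def)
    moreover have "(\<lambda>k. \<integral>\<omega>. indicator (B k) \<omega> * Y (real m) \<omega> \<partial>M) \<longlonglongrightarrow> (\<integral>\<omega>. Y (real m) \<omega> \<partial>M)"
    proof (rule integral_dominated_convergence[where w = "\<lambda>\<omega>. \<bar>Y (real m) \<omega>\<bar>"])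
      show "AE \<omega> in M. (\<lambda>k. indicator (B k) \<omega> * Y (real m) \<omega>) \<longlonglongrightarrow> Y (real m) \<omega>"
        using ev_B
      proof eventually_elim
        case (elim \<omega>)
        show ?case
          by (rule tendsto_eventually)
             (use elim in \<open>auto elim: eventually_mono simp: indicator_def\<close>)
      qed
    qed (auto simp: indicator_def int)
    ultimately show ?thesis
      using False by (simp add: eq LIMSEQ_unique)
  qed
qed

end

section \<open>The probability of never crossing a barrier\<close>

text \<open>The two inequalities trap the negated difference quotient of \<open>G\<close> between
  the values of G / \<phi> at the two endpoints. Continuity of \<open>G\<close> then yields the
  derivative, and an integrating factor solves the equation.\<close>

lemma decay_equation_unique:
  fixes G \<phi> :: "real \<Rightarrow> real"
  assumes cont: "continuous_on {0..} \<phi>" and mono: "mono_on {0..} \<phi>"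
    and pos: "\<And>u. 0 \<le> u \<Longrightarrow> 0 < \<phi> u"
    and G_0: "G 0 = 1" and G_nonneg: "\<And>u. 0 \<le> u \<Longrightarrow> 0 \<le> G u"
    and upper: "\<And>u v. 0 \<le> u \<Longrightarrow> u \<le> v \<Longrightarrow> \<phi> u * (G u - G v) \<le> (v - u) * G u"
    and lower: "\<And>u v. 0 \<le> u \<Longrightarrow> u \<le> v \<Longrightarrow> (v - u) * G v \<le> \<phi> v * (G u - G v)"
    and u: "0 \<le> u"
  shows "G u = exp (- integral {0..u} (\<lambda>s. 1 / \<phi> s))"
proof -
  have drop_le: "G s - G t \<le> (t - s) * (G s / \<phi> s)" if "0 \<le> s" "s \<le> t" for s t
    using upper[OF that] pos[OF that(1)] by (simp add: field_simps)
  have drop_ge: "(t - s) * (G t / \<phi> t) \<le> G s - G t" if "0 \<le> s" "s \<le> t" for s t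
    using lower[OF that] pos[of t] that by (simp add: field_simps)
  have antimono: "G t \<le> G s" if "0 \<le> s" "s \<le> t" for s t
  proof -
    have "0 \<le> (t - s) * (G t / \<phi> t)"
      using that pos[of t] G_nonneg[of t] by simp
    then show ?thesis
      using drop_ge[OF that] by simp
  qed
  \<comment> \<open>Since \<open>G\<close> is at most 1 and \<phi> is increasing, G / \<phi> is
    bounded by 1 / \<phi> 0. The resulting Lipschitz bound supplies the continuity of
    \<open>G\<close>.\<close>
  have lip: "G s - G t \<le> (t - s) / \<phi> 0" if "0 \<le> s" "s \<le> t" for s t
  proof -
    have "\<phi> 0 \<le> \<phi> s"
      using mono that by (auto intro: mono_onD)
    then have "G s / \<phi> s \<le> 1 / \<phi> 0"
      using antimono[of 0 s] that pos G_0 by (intro frac_le) auto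
    then have "(t - s) * (G s / \<phi> s) \<le> (t - s) * (1 / \<phi> 0)"
      using that by (intro mult_left_mono) auto
    then show ?thesis
      using drop_le[OF that] by simp
  qed
  have lip_abs: "\<bar>G s - G t\<bar> \<le> \<bar>s - t\<bar> / \<phi> 0" if "0 \<le> s" "0 \<le> t" for s t
    using lip[of s t] lip[of t s] antimono[of s t] antimono[of t s] that by (cases "s \<le> t") auto
  have G_cont: "continuous_on {0..} G"
  proof (rule continuous_onI)
    fix s e :: real assume "s \<in> {0..}" "0 < e"
    show "\<exists>d>0. \<forall>t\<in>{0..}. dist t s < d \<longrightarrow> dist (G t) (G s) \<le> e"
    proof (intro exI conjI ballI impI)
      show "0 < e * \<phi> 0"
        using \<open>0 < e\<close> pos[of 0] by simp
      fix t assume t: "t \<in> {0..}" "dist t s < e * \<phi> 0"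
      then have "\<bar>t - s\<bar> / \<phi> 0 \<le> e"
        using pos[of 0] by (simp add: dist_real_def pos_divide_le_eq)
      then show "dist (G t) (G s) \<le> e"
        using lip_abs[of t s] t \<open>s \<in> {0..}\<close> by (simp add: dist_real_def)
    qed
  qed
  have G_deriv: "(G has_real_derivative - (G s / \<phi> s)) (at s within {0..})" if s: "0 \<le> s" for s
    unfolding has_field_derivative_iff
  proof (rule LIM_zero_cancel, rule Lim_null_comparison)
    have "continuous_on {0..} (\<lambda>t. G t / \<phi> t)"
      using G_cont cont pos by (intro continuous_on_divide) (auto simp: less_imp_neq[symmetric])
    then have "((\<lambda>t. G t / \<phi> t) \<longlongrightarrow> G s / \<phi> s) (at s within {0..})"
      using s by (auto simp: continuous_on_def)
    then show "((\<lambda>t. \<bar>G t / \<phi> t - G s / \<phi> s\<bar>) \<longlongrightarrow> 0) (at s within {0..})"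
      by (intro tendsto_rabs_zero LIM_zero)
    show "\<forall>\<^sub>F t in at s within {0..}. norm ((G t - G s) / (t - s) - - (G s / \<phi> s)) \<le> \<bar>G t / \<phi> t - G s / \<phi> s\<bar>"
      unfolding eventually_at_filter
    proof (rule always_eventually, intro allI impI)
      fix t assume t: "t \<noteq> s" "t \<in> {0..}"
      \<comment> \<open>The negated difference quotient. Which endpoint gives the lower bound
        depends on the side from which \<open>t\<close> approaches \<open>s\<close>, hence the
        disjunction below.\<close>
      define q where "q = (G s - G t) / (t - s)"
      have q: "G t / \<phi> t \<le> q \<and> q \<le> G s / \<phi> s \<or> G s / \<phi> s \<le> q \<and> q \<le> G t / \<phi> t"
      proof (cases "s < t")
        case True
        then show ?thesis
          using drop_le[of s t] drop_ge[of s t] s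
          by (simp add: q_def pos_le_divide_eq pos_divide_le_eq mult.commute)
      next
        case False
        then have "t < s" using t by simp
        moreover have "q = (G t - G s) / (s - t)"
          unfolding q_def by (metis minus_diff_eq minus_divide_divide)
        ultimately show ?thesis
          using drop_le[of t s] drop_ge[of t s] t
          by (simp add: pos_le_divide_eq pos_divide_le_eq mult.commute)
      qed
      have "(G t - G s) / (t - s) = - q"
        unfolding q_def by (metis minus_diff_eq minus_divide_left)
      then show "norm ((G t - G s) / (t - s) - - (G s / \<phi> s)) \<le> \<bar>G t / \<phi> t - G s / \<phi> s\<bar>"
        using q by auto
    qed
  qed
  define \<Phi> where "\<Phi> u = integral {0..u} (\<lambda>s. 1 / \<phi> s)" for u
  have inv_cont: "continuous_on {0..u} (\<lambda>s. 1 / \<phi> s)"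
    using cont pos by (intro continuous_on_divide) (auto intro: continuous_on_subset simp: less_imp_neq[symmetric])
  \<comment> \<open>The integrating factor is \<open>exp (\<Phi> s)\<close>; at 0 the constant is
    seen to be 1.\<close>
  have "\<exists>c. \<forall>s\<in>{0..u}. G s * exp (\<Phi> s) = c"
  proof (rule has_field_derivative_zero_constant)
    fix s assume s: "s \<in> {0..u}"
    have "(\<Phi> has_real_derivative 1 / \<phi> s) (at s within {0..u})"
      unfolding \<Phi>_def using inv_cont s by (rule integral_has_real_derivative)
    moreover have "(G has_real_derivative - (G s / \<phi> s)) (at s within {0..u})"
      using G_deriv[of s] s by (auto intro: DERIV_subset)
    ultimately show "((\<lambda>s. G s * exp (\<Phi> s)) has_real_derivative 0) (at s within {0..u})"
      by (auto intro!: derivative_eq_intros)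
  qed simp
  then have "G u * exp (\<Phi> u) = G 0 * exp (\<Phi> 0)"
    using u by force
  then have "G u * exp (\<Phi> u) = 1"
    by (simp add: G_0 \<Phi>_def)
  then show ?thesis
    by (simp add: \<Phi>_def exp_minus field_simps)
qed

lemma continuous_at_right_eq:
  fixes f g :: "real \<Rightarrow> real"
  assumes "\<forall>t\<ge>0. f t = g t" "0 \<le> t" "continuous (at_right t) f"
  shows "continuous (at_right t) g"
proof -
  have "\<forall>\<^sub>F s in at_right t. f s = g s"
    using assms by (intro eventually_at_rightI[of t "t + 1"]) auto
  moreover have "(f \<longlongrightarrow> g t) (at_right t)"
    using assms by (auto simp: continuous_within)
  ultimately show ?thesis
    unfolding continuous_within by (rule Lim_transform_eventually[rotated])
qed

lemma stopped_right_continuous: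
  assumes "\<And>t. 0 \<le> t \<Longrightarrow> continuous (at_right t) (\<lambda>t. Y t \<omega>)" "0 \<le> t"
  shows "continuous (at_right t) (\<lambda>t. stopped Y T t \<omega>)"
proof (cases "ennreal t < T \<omega>")
  case True
  have "((\<lambda>s. ennreal s) \<longlongrightarrow> ennreal t) (at_right t)"
    by (intro tendsto_intros)
  then have "\<forall>\<^sub>F s in at_right t. ennreal s < T \<omega>"
    using True by (rule order_tendstoD(2))
  then have "\<forall>\<^sub>F s in at_right t. Y s \<omega> = stopped Y T s \<omega>"
    using eventually_at_right_less[of t]
    by eventually_elim (use assms(2) in \<open>auto simp: stopped_def min_def\<close>)
  moreover have "Y t \<omega> = stopped Y T t \<omega>"
    using True assms(2) by (auto simp: stopped_def min_def)
  moreover have "((\<lambda>t. Y t \<omega>) \<longlongrightarrow> Y t \<omega>) (at_right t)"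
    using assms by (auto simp: continuous_within)
  ultimately show ?thesis
    unfolding continuous_within by (auto intro: Lim_transform_eventually)
next
  case False
  have eq: "stopped Y T s \<omega> = stopped Y T t \<omega>" if "t \<le> s" for s
  proof -
    have "T \<omega> \<le> ennreal s"
      using False that ennreal_leI order_trans by (metis not_less)
    then show ?thesis
      using False by (simp add: stopped_def min_absorb2 not_less)
  qed
  have "\<forall>\<^sub>F s in at_right t. stopped Y T t \<omega> = stopped Y T s \<omega>"
    using eventually_at_right_less[of t] by eventually_elim (rule eq[symmetric], simp)
  then show ?thesis
    unfolding continuous_within by (rule Lim_transform_eventually[OF tendsto_const])
qed

section \<open>Crossing times of the process\<close>

locale sigma_process = usual_filtered_prob_space M F
  for M :: "'a measure" and F +
  fixes X N A :: "real \<Rightarrow> 'a \<Rightarrow> real" and \<phi> :: "real \<Rightarrow> real"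
  assumes class_Sigma: "class_Sigma M F X N A"
    and jumps: "only_negative_jumps M X"
    and A_top: "AE \<omega> in M. filterlim (\<lambda>t. A t \<omega>) at_top at_top"
    and phi_cont: "continuous_on {0..} \<phi>" and phi_mono: "mono_on {0..} \<phi>"
    and phi_pos: "\<And>u. 0 \<le> u \<Longrightarrow> 0 < \<phi> u"
    and phi_borel [measurable]: "\<phi> \<in> borel_measurable borel"
begin

text \<open>Bundles the almost sure path properties, so that each later argument discards a single
  exceptional set.\<close>

definition good :: "'a \<Rightarrow> bool" where
  "good \<omega> \<longleftrightarrow> sigma_path (\<lambda>t. X t \<omega>) (\<lambda>t. A t \<omega>) \<phi> \<and> (\<forall>t\<ge>0. X t \<omega> = N t \<omega> + A t \<omega>) \<and>
     (\<forall>t\<ge>0. continuous (at_right t) (\<lambda>t. N t \<omega>))"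

lemma AE_good: "AE \<omega> in M. good \<omega>"
proof -
  have *: "AE \<omega> in M. \<forall>t\<ge>0. 0 \<le> X t \<omega>" "AE \<omega> in M. \<forall>t\<ge>0. X t \<omega> = N t \<omega> + A t \<omega>"
    "AE \<omega> in M. cadlag_path (\<lambda>t. N t \<omega>) \<and> N 0 \<omega> = 0"
    "AE \<omega> in M. continuous_on {0..} (\<lambda>t. A t \<omega>) \<and> mono_on {0..} (\<lambda>t. A t \<omega>) \<and> A 0 \<omega> = 0"
    "AE \<omega> in M. AE t in path_measure (\<lambda>t. A t \<omega>). 0 \<le> t \<longrightarrow> X t \<omega> = 0"
    using class_Sigma unfolding class_Sigma_def by auto
  have j: "AE \<omega> in M. \<forall>t>0. X t \<omega> - Lim (at_left t) (\<lambda>s. X s \<omega>) \<le> 0"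
    using jumps unfolding only_negative_jumps_def .
  show ?thesis
    using * j A_top
  proof eventually_elim
    case (elim \<omega>)
    have N_right: "continuous (at_right t) (\<lambda>t. N t \<omega>)" if "0 \<le> t" for t
      using elim(3) that by (simp add: cadlag_path_def)
    have A_cont: "continuous_on {0..} (\<lambda>t. A t \<omega>)"
      using elim(4) by blast
    have A_right: "continuous (at_right t) (\<lambda>t. A t \<omega>)" if "0 \<le> t" for t
      unfolding continuous_within using A_cont that by (rule tendsto_at_right_half)
    have A_left: "((\<lambda>t. A t \<omega>) \<longlongrightarrow> A t \<omega>) (at_left t)" if "0 < t" for t
      using A_cont that by (rule tendsto_at_left_half)
    have "sigma_path (\<lambda>t. X t \<omega>) (\<lambda>t. A t \<omega>) \<phi>"
    proof
      show "continuous_on {0..} (\<lambda>t. A t \<omega>)" "mono_on {0..} (\<lambda>t. A t \<omega>)" "A 0 \<omega> = 0"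
        "filterlim (\<lambda>t. A t \<omega>) at_top at_top" "X 0 \<omega> = 0"
        "AE t in path_measure (\<lambda>t. A t \<omega>). 0 \<le> t \<longrightarrow> X t \<omega> = 0"
        using elim(2-5,7) by simp_all
      show "0 \<le> X t \<omega>" if "0 \<le> t" for t
        using elim(1) that by blast
      show "continuous (at_right t) (\<lambda>t. X t \<omega>)" if "0 \<le> t" for t
        by (rule continuous_at_right_eq[of "\<lambda>t. N t \<omega> + A t \<omega>"])
           (use elim(2) that N_right A_right in \<open>auto intro: continuous_add\<close>)
      show "\<exists>l. ((\<lambda>t. X t \<omega>) \<longlongrightarrow> l) (at_left t) \<and> X t \<omega> \<le> l" if t: "0 < t" for t
      proof -
        obtain l where "((\<lambda>t. N t \<omega>) \<longlongrightarrow> l) (at_left t)"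
          using elim(3) t by (auto simp: cadlag_path_def)
        then have "((\<lambda>t. N t \<omega> + A t \<omega>) \<longlongrightarrow> l + A t \<omega>) (at_left t)"
          by (intro tendsto_add A_left t)
        moreover have "\<forall>\<^sub>F s in at_left t. N s \<omega> + A s \<omega> = X s \<omega>"
          using elim(2) t by (intro eventually_at_leftI[of 0]) auto
        ultimately have lim: "((\<lambda>t. X t \<omega>) \<longlongrightarrow> l + A t \<omega>) (at_left t)"
          by (rule Lim_transform_eventually)
        \<comment> \<open>\<open>Lim\<close> is a description operator; the jump hypothesis becomes
          usable only once a left limit has been exhibited.\<close>
        then have "Lim (at_left t) (\<lambda>s. X s \<omega>) = l + A t \<omega>"
          by (intro tendsto_Lim) auto
        then show ?thesis
          using lim elim(6) t by fastforce
      qed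
    qed (rule phi_cont phi_mono phi_pos | assumption)+
    then show ?case
      using elim(2) N_right by (simp add: good_def)
  qed
qed

text \<open>The default 0 keeps the time nonnegative on every outcome, as optional stopping
  requires.\<close>

definition hit_time :: "real \<Rightarrow> 'a \<Rightarrow> real" where
  "hit_time u \<omega> = (if good \<omega> then sigma_path.hit (\<lambda>t. X t \<omega>) (\<lambda>t. A t \<omega>) \<phi> u else 0)"

abbreviation safe_path :: "real \<Rightarrow> 'a \<Rightarrow> bool" where
  "safe_path u \<omega> \<equiv> sigma_path.safe (\<lambda>t. X t \<omega>) (\<lambda>t. A t \<omega>) \<phi> u"

definition safe_event :: "real \<Rightarrow> 'a set" where
  "safe_event u = {\<omega>\<in>space M. good \<omega> \<and> safe_path u \<omega>}"

lemma good_path: "good \<omega> \<Longrightarrow> sigma_path (\<lambda>t. X t \<omega>) (\<lambda>t. A t \<omega>) \<phi>"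
  by (simp add: good_def)

lemma hit_time_nonneg: "0 \<le> hit_time u \<omega>"
  using sigma_path.hit_nonneg[OF good_path] by (simp add: hit_time_def)

lemma X_F: "0 \<le> t \<Longrightarrow> X t \<in> borel_measurable (F t)"
  using class_Sigma by (auto simp: class_Sigma_def local_submartingale_def adapted_def)

lemma A_F: "0 \<le> t \<Longrightarrow> A t \<in> borel_measurable (F t)"
  using class_Sigma by (auto simp: class_Sigma_def adapted_def)

lemma N_F: "0 \<le> t \<Longrightarrow> N t \<in> borel_measurable (F t)"
  using class_Sigma by (auto simp: class_Sigma_def local_martingale_def adapted_def)

lemma hit_time_stopping:
  assumes "0 < s"
  shows "Measurable.pred (F s) (\<lambda>\<omega>. hit_time u \<omega> < s)"
proof -
  let ?Q = "{t. 0 \<le> t \<and> t < s \<and> t \<in> \<rat>}"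
  have [simp]: "space (F s) = space M"
    using assms by (intro space_F) simp
  define B where "B = (\<Union>t\<in>?Q. {\<omega>\<in>space (F s). \<phi> (A t \<omega>) < X t \<omega> \<or> u < A t \<omega>})"
  have B: "B \<in> sets (F s)"
    unfolding B_def
  proof (rule sets.countable_UN')
    show "countable ?Q"
      by (rule countable_subset[OF _ countable_rat]) auto
    show "(\<lambda>t. {\<omega>\<in>space (F s). \<phi> (A t \<omega>) < X t \<omega> \<or> u < A t \<omega>}) ` ?Q \<subseteq> sets (F s)"
    proof clarify
      fix t assume t: "0 \<le> t" "t < s"
      have [measurable]: "A t \<in> borel_measurable (F s)" "X t \<in> borel_measurable (F s)"
        using t by (auto intro: measurable_F_mono[OF _ _ A_F] measurable_F_mono[OF _ _ X_F])
      show "{\<omega>\<in>space (F s). \<phi> (A t \<omega>) < X t \<omega> \<or> u < A t \<omega>} \<in> sets (F s)"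
        by measurable
    qed
  qed
  have "{\<omega>\<in>space M. hit_time u \<omega> < s} \<in> sets (F s)"
  proof (rule sets_F_AE[OF _ B])
    show "AE \<omega> in M. \<omega> \<in> B \<longleftrightarrow> \<omega> \<in> {\<omega>\<in>space M. hit_time u \<omega> < s}"
      using AE_good AE_space
    proof eventually_elim
      case (elim \<omega>)
      interpret sigma_path "\<lambda>t. X t \<omega>" "\<lambda>t. A t \<omega>" \<phi>
        by (rule good_path[OF elim(1)])
      show ?case
        using elim hit_less_iff_rat[of u s] by (auto simp: B_def hit_time_def)
    qed
  qed (use assms in auto)
  then show ?thesis
    by (simp add: pred_def)
qed

lemma hit_time_measurable [measurable]: "hit_time u \<in> borel_measurable M"
  by (rule measurable_pred_less_imp_measurable[OF hit_time_nonneg hit_time_stopping])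

lemma AE_right: "AE \<omega> in M. \<forall>t\<ge>0. continuous (at_right t) (\<lambda>t. X t \<omega>)"
  "AE \<omega> in M. \<forall>t\<ge>0. continuous (at_right t) (\<lambda>t. A t \<omega>)"
  "AE \<omega> in M. \<forall>t\<ge>0. continuous (at_right t) (\<lambda>t. N t \<omega>)"
  using AE_good
proof (eventually_elim, goal_cases)
  case (1 \<omega>)
  then show ?case
    using sigma_path.x_right[OF good_path] by blast
next
  case 2
  show ?case
    using AE_good
  proof eventually_elim
    case (elim \<omega>)
    interpret sigma_path "\<lambda>t. X t \<omega>" "\<lambda>t. A t \<omega>" \<phi>
      by (rule good_path[OF elim])
    show ?case
      using tendsto_at_right_half[OF a_cont] by (simp add: continuous_within)
  qed
next
  case 3
  show ?case
    using AE_good by eventually_elim (simp add: good_def)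
qed

lemma X_hit_measurable [measurable]: "(\<lambda>\<omega>. X (hit_time u \<omega>) \<omega>) \<in> borel_measurable M"
  by (rule evaluation_at_random_time_measurable)
     (auto intro: measurable_F_imp_M[OF _ X_F] AE_right hit_time_nonneg)

lemma A_hit_measurable [measurable]: "(\<lambda>\<omega>. A (hit_time u \<omega>) \<omega>) \<in> borel_measurable M"
  by (rule evaluation_at_random_time_measurable)
     (auto intro: measurable_F_imp_M[OF _ A_F] AE_right hit_time_nonneg)

lemma N_hit_measurable [measurable]: "(\<lambda>\<omega>. N (hit_time u \<omega>) \<omega>) \<in> borel_measurable M"
  by (rule evaluation_at_random_time_measurable)
     (auto intro: measurable_F_imp_M[OF _ N_F] AE_right hit_time_nonneg)

lemma until_hit_time:
  assumes "good \<omega>" "0 \<le> u" "0 \<le> t" "t \<le> hit_time u \<omega>"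
  shows "0 \<le> X t \<omega>" "X t \<omega> \<le> \<phi> u" "0 \<le> A t \<omega>" "A t \<omega> \<le> u" "\<bar>N t \<omega>\<bar> \<le> \<phi> u + u"
proof -
  interpret sigma_path "\<lambda>t. X t \<omega>" "\<lambda>t. A t \<omega>" \<phi>
    by (rule good_path[OF assms(1)])
  show *: "0 \<le> X t \<omega>" "X t \<omega> \<le> \<phi> u" "0 \<le> A t \<omega>" "A t \<omega> \<le> u"
    using assms x_nonneg until_hit_bound[of u t] until_hit[of u t] a_nonneg by (auto simp: hit_time_def)
  have "X t \<omega> = N t \<omega> + A t \<omega>"
    using assms by (simp add: good_def)
  then show "\<bar>N t \<omega>\<bar> \<le> \<phi> u + u"
    using * phi_pos[OF assms(2)] assms(2) by (simp add: abs_le_iff)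
qed

text \<open>Up to the crossing time |N| is at most \<phi> u + u, and this bound survives any further
  stopping. It justifies optional stopping for the localized martingales and dominated convergence
  when the localization is removed.\<close>

lemma N_hit_expectation:
  assumes u: "0 \<le> u"
  shows "(\<integral>\<omega>. N (hit_time u \<omega>) \<omega> \<partial>M) = 0"
proof -
  obtain T where T: "localizing_sequence M F T" "\<And>n. martingale M F (stopped N (T n))"
    using class_Sigma by (auto simp: class_Sigma_def local_martingale_def)
  define Y where "Y n = stopped N (T n)" for n
  \<comment> \<open>The same index \<open>n\<close> drives the localization and the deterministic
    cap, so only one limit is taken.\<close>
  define f where "f n \<omega> = Y n (min (real n) (hit_time u \<omega>)) \<omega>" for n \<omega>
  have right: "AE \<omega> in M. \<forall>t\<ge>0. continuous (at_right t) (\<lambda>t. Y n t \<omega>)" for n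
    using AE_right(3) by eventually_elim (auto simp: Y_def intro!: stopped_right_continuous)
  have bound: "AE \<omega> in M. \<bar>f n \<omega>\<bar> \<le> \<phi> u + u" for n
    using AE_good
  proof eventually_elim
    case (elim \<omega>)
    let ?r = "enn2real (min (ennreal (min (real n) (hit_time u \<omega>))) (T n \<omega>))"
    have "?r \<le> enn2real (ennreal (min (real n) (hit_time u \<omega>)))"
      by (rule enn2real_mono) auto
    then have "?r \<le> hit_time u \<omega>"
      using hit_time_nonneg[of u \<omega>] by simp
    then have "\<bar>N ?r \<omega>\<bar> \<le> \<phi> u + u"
      by (intro until_hit_time[OF elim u]) auto
    then show ?case
      by (simp add: f_def Y_def stopped_def)
  qed
  have Y_M: "Y n t \<in> borel_measurable M" if "0 \<le> t" for n t
    using T(2)[of n] that by (auto simp: Y_def martingale_def)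
  have [measurable]: "f n \<in> borel_measurable M" for n
    unfolding f_def
    by (rule evaluation_at_random_time_measurable[OF Y_M right]) (auto intro: hit_time_nonneg)
  have "(\<integral>\<omega>. f n \<omega> \<partial>M) = 0" for n
  proof -
    have "(\<integral>\<omega>. f n \<omega> \<partial>M) = (\<integral>\<omega>. Y n (real n) \<omega> \<partial>M)"
      unfolding f_def
      by (rule optional_stopping_bounded[OF _ right hit_time_nonneg hit_time_stopping])
         (use T(2) bound in \<open>auto simp: Y_def f_def\<close>)
    also have "\<dots> = (\<integral>\<omega>. Y n 0 \<omega> \<partial>M)"
    proof -
      have "(\<integral>\<omega>. indicator (space M) \<omega> * Y n 0 \<omega> \<partial>M) = (\<integral>\<omega>. indicator (space M) \<omega> * Y n (real n) \<omega> \<partial>M)"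
        unfolding Y_def using sets.top[of "F 0"] space_F[of 0] by (intro martingale_integral_on[OF T(2)]) auto
      moreover have "(\<integral>\<omega>. indicator (space M) \<omega> * g \<omega> \<partial>M) = (\<integral>\<omega>. g \<omega> \<partial>M)" for g :: "'a \<Rightarrow> real"
        by (rule Bochner_Integration.integral_cong) auto
      ultimately show ?thesis by simp
    qed
    also have "\<dots> = (\<integral>\<omega>. 0 \<partial>M)"
    proof (rule integral_cong_AE)
      have "AE \<omega> in M. N 0 \<omega> = 0"
        using class_Sigma by (auto simp: class_Sigma_def)
      then show "AE \<omega> in M. Y n 0 \<omega> = 0"
        by eventually_elim (simp add: Y_def stopped_def)
    qed (auto intro: Y_M)
    finally show ?thesis by simp
  qed
  moreover have "(\<lambda>n. \<integral>\<omega>. f n \<omega> \<partial>M) \<longlonglongrightarrow> (\<integral>\<omega>. N (hit_time u \<omega>) \<omega> \<partial>M)"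
  proof (rule integral_dominated_convergence[where w = "\<lambda>_. \<phi> u + u"])
    have "AE \<omega> in M. (\<lambda>n. T n \<omega>) \<longlonglongrightarrow> \<infinity>"
      using T(1) by (auto simp: localizing_sequence_def)
    then show "AE \<omega> in M. (\<lambda>n. f n \<omega>) \<longlonglongrightarrow> N (hit_time u \<omega>) \<omega>"
    proof eventually_elim
      case (elim \<omega>)
      \<comment> \<open>On each such path both the localizing time and the cap eventually lie beyond
        the finite crossing time, so the sequence is eventually constant.\<close>
      have "\<forall>\<^sub>F n in sequentially. ennreal (hit_time u \<omega>) < T n \<omega>"
        using elim by (rule order_tendstoD(1)) simp
      moreover have "\<forall>\<^sub>F n in sequentially. hit_time u \<omega> \<le> real n"
        by (rule eventually_ge_at_top[THEN eventually_mono, of "nat \<lceil>hit_time u \<omega>\<rceil>"]) linarith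
      ultimately have "\<forall>\<^sub>F n in sequentially. f n \<omega> = N (hit_time u \<omega>) \<omega>"
        by eventually_elim (auto simp: f_def Y_def stopped_def min_absorb1 min_absorb2 less_imp_le hit_time_nonneg)
      then show ?case
        by (rule tendsto_eventually)
    qed
  qed (use bound in auto)
  ultimately show ?thesis
    using LIMSEQ_unique[OF _ tendsto_const] by simp
qed

lemma X_hit_integrable:
  assumes "0 \<le> u"
  shows "integrable M (\<lambda>\<omega>. X (hit_time u \<omega>) \<omega>)"
proof (rule integrable_const_bound)
  show "AE \<omega> in M. norm (X (hit_time u \<omega>) \<omega>) \<le> \<phi> u"
    using AE_good
  proof eventually_elim
    case (elim \<omega>)
    then show ?case
      using until_hit_time(1,2)[OF elim assms hit_time_nonneg order_refl] by simp
  qed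
qed measurable

lemma A_hit_integrable:
  assumes "0 \<le> u"
  shows "integrable M (\<lambda>\<omega>. A (hit_time u \<omega>) \<omega>)"
proof (rule integrable_const_bound)
  show "AE \<omega> in M. norm (A (hit_time u \<omega>) \<omega>) \<le> u"
    using AE_good
  proof eventually_elim
    case (elim \<omega>)
    then show ?case
      using until_hit_time(3,4)[OF elim assms hit_time_nonneg order_refl] by simp
  qed
qed measurable

lemma X_hit_expectation:
  assumes "0 \<le> u"
  shows "(\<integral>\<omega>. X (hit_time u \<omega>) \<omega> \<partial>M) = (\<integral>\<omega>. A (hit_time u \<omega>) \<omega> \<partial>M)"
proof -
  have "(\<integral>\<omega>. N (hit_time u \<omega>) \<omega> \<partial>M) = (\<integral>\<omega>. X (hit_time u \<omega>) \<omega> - A (hit_time u \<omega>) \<omega> \<partial>M)"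
  proof (rule integral_cong_AE)
    show "AE \<omega> in M. N (hit_time u \<omega>) \<omega> = X (hit_time u \<omega>) \<omega> - A (hit_time u \<omega>) \<omega>"
      using AE_good by eventually_elim (simp add: good_def hit_time_nonneg)
  qed measurable
  also have "\<dots> = (\<integral>\<omega>. X (hit_time u \<omega>) \<omega> \<partial>M) - (\<integral>\<omega>. A (hit_time u \<omega>) \<omega> \<partial>M)"
    by (rule Bochner_Integration.integral_diff[OF X_hit_integrable[OF assms] A_hit_integrable[OF assms]])
  finally show ?thesis
    using N_hit_expectation[OF assms] by simp
qed

lemma safe_event_measurable [measurable]:
  assumes "0 \<le> u"
  shows "safe_event u \<in> sets M"
proof (rule in_sets_AE)
  show "{\<omega>\<in>space M. X (hit_time u \<omega>) \<omega> = 0} \<in> sets M"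
    by measurable
  show "AE \<omega> in M. \<omega> \<in> {\<omega>\<in>space M. X (hit_time u \<omega>) \<omega> = 0} \<longleftrightarrow> \<omega> \<in> safe_event u"
    using AE_good
  proof eventually_elim
    case (elim \<omega>)
    then show ?case
      using sigma_path.safe_iff_hit[OF good_path[OF elim] assms] by (auto simp: safe_event_def hit_time_def)
  qed
qed (auto simp: safe_event_def)

text \<open>Both bounds come from subtracting the identities \<open>E X = E A\<close> at the crossing times of levels \<open>u\<close> and \<open>v\<close>;
  dividing by \<open>v - u\<close> they squeeze the derivative of the probability.\<close>

lemma safe_event_ineqs:
  assumes "0 \<le> u" "u \<le> v"
  shows "\<phi> u * (prob (safe_event u) - prob (safe_event v)) \<le> (v - u) * prob (safe_event u)"
    and "(v - u) * prob (safe_event v) \<le> \<phi> v * (prob (safe_event u) - prob (safe_event v))"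
proof -
  have v: "0 \<le> v" using assms by simp
  note [measurable] = safe_event_measurable[OF assms(1)] safe_event_measurable[OF v]
  note [simp] = X_hit_integrable[OF assms(1)] X_hit_integrable[OF v]
    A_hit_integrable[OF assms(1)] A_hit_integrable[OF v]
  let ?I = "\<lambda>u \<omega>. indicator (safe_event u) \<omega> :: real"
  have pointwise: "AE \<omega> in M. \<phi> u * (?I u \<omega> - ?I v \<omega>) \<le> X (hit_time v \<omega>) \<omega> - X (hit_time u \<omega>) \<omega>"
    "AE \<omega> in M. X (hit_time v \<omega>) \<omega> - X (hit_time u \<omega>) \<omega> \<le> \<phi> v * (?I u \<omega> - ?I v \<omega>)"
    "AE \<omega> in M. (v - u) * ?I v \<omega> \<le> A (hit_time v \<omega>) \<omega> - A (hit_time u \<omega>) \<omega>"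
    "AE \<omega> in M. A (hit_time v \<omega>) \<omega> - A (hit_time u \<omega>) \<omega> \<le> (v - u) * ?I u \<omega>"
  proof -
    have *: "AE \<omega> in M. \<phi> u * (?I u \<omega> - ?I v \<omega>) \<le> X (hit_time v \<omega>) \<omega> - X (hit_time u \<omega>) \<omega> \<and>
      X (hit_time v \<omega>) \<omega> - X (hit_time u \<omega>) \<omega> \<le> \<phi> v * (?I u \<omega> - ?I v \<omega>) \<and>
      (v - u) * ?I v \<omega> \<le> A (hit_time v \<omega>) \<omega> - A (hit_time u \<omega>) \<omega> \<and>
      A (hit_time v \<omega>) \<omega> - A (hit_time u \<omega>) \<omega> \<le> (v - u) * ?I u \<omega>"
      using AE_good AE_space
    proof eventually_elim
      case (elim \<omega>)
      have "?I w \<omega> = of_bool (safe_path w \<omega>)" for w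
        using elim by (simp add: safe_event_def indicator_def)
      then show ?case
        using sigma_path.hit_increments[OF good_path[OF elim(1)] assms] elim(1)
        by (simp add: hit_time_def)
    qed
    show "AE \<omega> in M. \<phi> u * (?I u \<omega> - ?I v \<omega>) \<le> X (hit_time v \<omega>) \<omega> - X (hit_time u \<omega>) \<omega>"
      "AE \<omega> in M. X (hit_time v \<omega>) \<omega> - X (hit_time u \<omega>) \<omega> \<le> \<phi> v * (?I u \<omega> - ?I v \<omega>)"
      "AE \<omega> in M. (v - u) * ?I v \<omega> \<le> A (hit_time v \<omega>) \<omega> - A (hit_time u \<omega>) \<omega>"
      "AE \<omega> in M. A (hit_time v \<omega>) \<omega> - A (hit_time u \<omega>) \<omega> \<le> (v - u) * ?I u \<omega>"
      using * by (eventually_elim, simp)+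
  qed
  have I_int [simp]: "integrable M (?I u)" "integrable M (?I v)"
    by (auto intro!: integrable_real_indicator simp: emeasure_eq_measure)
  have "(\<integral>\<omega>. \<phi> u * (?I u \<omega> - ?I v \<omega>) \<partial>M) \<le> (\<integral>\<omega>. X (hit_time v \<omega>) \<omega> - X (hit_time u \<omega>) \<omega> \<partial>M)"
    "(\<integral>\<omega>. X (hit_time v \<omega>) \<omega> - X (hit_time u \<omega>) \<omega> \<partial>M) \<le> (\<integral>\<omega>. \<phi> v * (?I u \<omega> - ?I v \<omega>) \<partial>M)"
    "(\<integral>\<omega>. (v - u) * ?I v \<omega> \<partial>M) \<le> (\<integral>\<omega>. A (hit_time v \<omega>) \<omega> - A (hit_time u \<omega>) \<omega> \<partial>M)"
    "(\<integral>\<omega>. A (hit_time v \<omega>) \<omega> - A (hit_time u \<omega>) \<omega> \<partial>M) \<le> (\<integral>\<omega>. (v - u) * ?I u \<omega> \<partial>M)"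
    by (intro integral_mono_AE pointwise; simp)+
  then show "\<phi> u * (prob (safe_event u) - prob (safe_event v)) \<le> (v - u) * prob (safe_event u)"
    "(v - u) * prob (safe_event v) \<le> \<phi> v * (prob (safe_event u) - prob (safe_event v))"
    using X_hit_expectation[OF assms(1)] X_hit_expectation[OF v] by simp_all
qed

text \<open>Up to \<open>hit_time 0\<close> the clock is still 0, so \<open>X\<close> there has
  expectation 0. Being nonnegative it vanishes almost surely, which means safety.\<close>

lemma prob_safe_0: "prob (safe_event 0) = 1"
proof -
  have [measurable]: "safe_event 0 \<in> sets M" by (rule safe_event_measurable) simp
  have A0: "AE \<omega> in M. A (hit_time 0 \<omega>) \<omega> = 0"
    using AE_good
  proof eventually_elim
    case (elim \<omega>)
    then show ?case
      using until_hit_time(3,4)[OF elim order_refl hit_time_nonneg order_refl] by simp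
  qed
  have "(\<integral>\<omega>. X (hit_time 0 \<omega>) \<omega> \<partial>M) = (\<integral>\<omega>. A (hit_time 0 \<omega>) \<omega> \<partial>M)"
    by (rule X_hit_expectation) simp
  also have "\<dots> = (\<integral>\<omega>. 0 \<partial>M)"
    by (rule integral_cong_AE)
       (use A0 in auto)
  finally have zero: "(\<integral>\<omega>. X (hit_time 0 \<omega>) \<omega> \<partial>M) = 0" by simp
  have "AE \<omega> in M. X (hit_time 0 \<omega>) \<omega> = 0"
  proof (subst integral_nonneg_eq_0_iff_AE[symmetric])
    show "AE \<omega> in M. 0 \<le> X (hit_time 0 \<omega>) \<omega>"
      using AE_good by eventually_elim (rule until_hit_time(1)[OF _ order_refl hit_time_nonneg order_refl])
  qed (use zero X_hit_integrable[of 0] in auto)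
  then have "AE \<omega> in M. \<omega> \<in> safe_event 0"
    using AE_good AE_space
  proof eventually_elim
    case (elim \<omega>)
    then show ?case
      using sigma_path.safe_iff_hit[OF good_path[OF elim(2)], of 0] by (simp add: safe_event_def hit_time_def)
  qed
  then show ?thesis
    by (simp add: prob_eq_1)
qed

lemma prob_safe:
  assumes "0 \<le> u"
  shows "prob (safe_event u) = exp (- integral {0..u} (\<lambda>s. 1 / \<phi> s))"
  by (rule decay_equation_unique[OF phi_cont phi_mono phi_pos, of "\<lambda>u. prob (safe_event u)"])
     (use assms prob_safe_0 safe_event_ineqs in auto)

text \<open>Each \<open>A t\<close> lies below some natural number, so safety at all integer levels
  is the absence of any crossing; the probabilities converge along this decreasing sequence.\<close>

lemma never_exceeds:
  assumes lim: "((\<lambda>u. integral {0..u} (\<lambda>s. 1 / \<phi> s)) \<longlongrightarrow> c) at_top"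
  shows "{\<omega>\<in>space M. \<forall>t\<ge>0. X t \<omega> \<le> \<phi> (A t \<omega>)} \<in> sets M"
    and "prob {\<omega>\<in>space M. \<forall>t\<ge>0. X t \<omega> \<le> \<phi> (A t \<omega>)} = exp (- c)"
proof -
  let ?E = "{\<omega>\<in>space M. \<forall>t\<ge>0. X t \<omega> \<le> \<phi> (A t \<omega>)}"
  let ?S = "\<Inter>n. safe_event (real n)"
  have S: "?S \<in> sets M"
    by (intro sets.countable_INT) (auto intro: safe_event_measurable)
  have eq: "AE \<omega> in M. \<omega> \<in> ?S \<longleftrightarrow> \<omega> \<in> ?E"
    using AE_good AE_space
  proof eventually_elim
    case (elim \<omega>)
    have "(\<forall>n. safe_path (real n) \<omega>) \<longleftrightarrow> (\<forall>t\<ge>0. X t \<omega> \<le> \<phi> (A t \<omega>))"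
      unfolding sigma_path.safe_def[OF good_path[OF elim(1)]] using real_arch_simple by blast
    then show ?case
      using elim by (auto simp: safe_event_def)
  qed
  show E: "?E \<in> sets M"
    by (rule in_sets_AE[OF eq S]) auto
  have "(\<lambda>n. prob (safe_event (real n))) \<longlonglongrightarrow> prob ?S"
  proof (rule finite_Lim_measure_decseq)
    show "decseq (\<lambda>n. safe_event (real n))"
      by (auto simp: decseq_def safe_event_def intro: sigma_path.safe_antimono[OF good_path, of _ "real _" "real _"])
  qed (use safe_event_measurable in force)
  moreover have "(\<lambda>n. prob (safe_event (real n))) \<longlonglongrightarrow> exp (- c)"
    using filterlim_compose[OF lim filterlim_real_sequentially]
    by (auto simp: prob_safe intro!: tendsto_intros)
  ultimately have "prob ?S = exp (- c)"
    by (rule LIMSEQ_unique)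
  moreover have "prob ?S = prob ?E"
    by (rule finite_measure_eq_AE[OF eq S E])
  ultimately show "prob ?E = exp (- c)" by simp
qed

end

section \<open>Power barriers\<close>

definition barrier :: "real \<Rightarrow> real \<Rightarrow> real \<Rightarrow> real \<Rightarrow> real" where
  "barrier p q y a = (y + a powr q) powr (1 / p)"

context
  fixes p q y :: real
  assumes p: "0 < p" and pq: "p < q" and y: "0 < y"
begin

lemma barrier_base_pos: "0 < y + a powr q"
  using y by (simp add: add_pos_nonneg)

lemma barrier_pos: "0 < barrier p q y a"
  using barrier_base_pos[of a] by (simp add: barrier_def)

lemma barrier_mono: "mono_on {0..} (barrier p q y)"
  unfolding barrier_def using p pq y by (auto intro!: mono_onI powr_mono2)

lemma barrier_cont: "continuous_on {0..} (barrier p q y)"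
proof -
  have "continuous_on {0..} (\<lambda>a::real. a powr q)"
    using p pq by (intro continuous_on_powr') (auto intro!: continuous_intros)
  then have "continuous_on {0..} (\<lambda>a. y + a powr q)"
    by (rule continuous_on_add[OF continuous_on_const])
  moreover have "\<forall>a\<in>{0..}. y + a powr q \<noteq> 0"
    using barrier_base_pos less_imp_neq by metis
  ultimately show ?thesis
    unfolding barrier_def by (intro continuous_on_powr continuous_on_const)
qed

lemma barrier_borel [measurable]: "barrier p q y \<in> borel_measurable borel"
  unfolding barrier_def by measurable

lemma le_barrier_iff:
  assumes "0 \<le> x"
  shows "x powr p - a powr q \<le> y \<longleftrightarrow> x \<le> barrier p q y a"
proof -
  let ?b = "barrier p q y a"
  have b: "?b powr p = y + a powr q"
    using p barrier_base_pos[of a] by (simp add: barrier_def powr_powr)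
  have "x powr p \<le> ?b powr p \<longleftrightarrow> x \<le> ?b"
    using assms p barrier_pos[of a] by (meson less_imp_le not_less powr_less_mono2 powr_mono2)
  then show ?thesis
    unfolding b by auto
qed

text \<open>On \<open>{0..1}\<close> the integrand is continuous because y > 0 keeps the barrier
  positive. Beyond 1 it is dominated by \<open>a powr - (q / p)\<close>, integrable because p <
  q.\<close>

lemma inverse_barrier_integrable: "set_integrable lborel {0..} (\<lambda>a. 1 / barrier p q y a)"
proof -
  have "set_integrable lebesgue {1..} (\<lambda>a::real. a powr - (q / p))"
    using has_integral_powr_to_inf[of "- (q / p)" 1] p pq
    by (intro nonnegative_absolutely_integrable_1) (auto simp: integrable_on_def)
  then have "set_integrable lborel {1..} (\<lambda>a::real. a powr - (q / p))"
    unfolding set_integrable_def by (subst (asm) integrable_completion) auto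
  then have "set_integrable lborel {1..} (\<lambda>a. 1 / barrier p q y a)"
  proof (rule set_integrable_bound)
    show "AE a in lborel. a \<in> {1..} \<longrightarrow> norm (1 / barrier p q y a) \<le> norm (a powr - (q / p))"
    proof (intro AE_I2 impI)
      fix a :: real assume "a \<in> {1..}"
      then have a: "0 < a" by simp
      have "a powr (q / p) = (a powr q) powr (1 / p)"
        by (simp add: powr_powr)
      also have "\<dots> \<le> barrier p q y a"
        unfolding barrier_def using p y by (intro powr_mono2) auto
      finally have "1 / barrier p q y a \<le> 1 / a powr (q / p)"
        using a by (intro divide_left_mono) (auto intro!: mult_pos_pos barrier_pos)
      then show "norm (1 / barrier p q y a) \<le> norm (a powr - (q / p))"
        using barrier_pos[of a] by (simp add: powr_minus_divide)
    qed
  qed (simp add: set_borel_measurable_def)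
  moreover have "set_integrable lborel {0..1} (\<lambda>a. 1 / barrier p q y a)"
    by (rule borel_integrable_atLeastAtMost')
       (use barrier_pos in \<open>auto intro!: continuous_on_divide continuous_on_subset[OF barrier_cont] simp: less_imp_neq[symmetric]\<close>)
  ultimately have "set_integrable lborel ({0..1} \<union> {1..}) (\<lambda>a. 1 / barrier p q y a)"
    by (intro set_integrable_Un) auto
  moreover have "{0..1} \<union> {1..} = {0::real..}" by auto
  ultimately show ?thesis by simp
qed

text \<open>The substitution z = a^q / y extracts \<open>y\<close> as a pure power, leaving a
  constant independent of the level. The factor \<open>q\<close> from the derivative cancels the
  prefactor of \<open>rate\<close>.\<close>

lemma rate_substitution: "rate p q = y powr (1 / p - 1 / q) * (LBINT a:{0<..}. 1 / barrier p q y a)"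
proof -
  have q: "0 < q" using p pq by simp
  define f where "f z = 1 / (z powr (1 - 1 / q) * (1 + z) powr (1 / p))" for z :: real
  define g where "g a = a powr q / y" for a :: real
  define g' where "g' a = q * a powr (q - 1) / y" for a :: real
  have eq: "f (g a) * g' a = q * y powr (1 / p - 1 / q) * (1 / barrier p q y a)" if a: "0 < a" for a
  proof -
    have 1: "g a powr (1 - 1 / q) = a powr (q - 1) / y powr (1 - 1 / q)"
      unfolding g_def using a y q by (simp add: powr_divide powr_powr right_diff_distrib)
    have "1 + g a = (y + a powr q) / y"
      using y by (simp add: g_def field_simps)
    then have 2: "(1 + g a) powr (1 / p) = barrier p q y a / y powr (1 / p)"
      using y barrier_base_pos[of a] by (simp add: powr_divide barrier_def)
    have 3: "y powr (1 / p - 1 / q) = y powr (1 - 1 / q) * y powr (1 / p) / y"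
      using y by (simp add: powr_diff)
    show ?thesis
      unfolding f_def 1 2 3 g'_def using a y q barrier_pos[of a] by (simp add: field_simps)
  qed
  have sub: "set_integrable lborel {0<..} (\<lambda>a. f (g a) * g' a)"
  proof -
    have "set_integrable lborel {0<..} (\<lambda>a. q * y powr (1 / p - 1 / q) * (1 / barrier p q y a))"
      by (intro set_integrable_mult_right set_integrable_subset[OF inverse_barrier_integrable]) auto
    then show ?thesis
      by (rule set_integrable_cong[THEN iffD1, rotated -1]) (auto simp: eq)
  qed
  have "(LBINT z=0..\<infinity>. f z) = (LBINT a=0..\<infinity>. f (g a) * g' a)"
  proof (rule interval_integral_substitution_nonneg(2))
    show "(0::ereal) < \<infinity>" by simp
    show "DERIV g a :> g' a" if "0 < ereal a" for a
      unfolding g_def g'_def using that y by (auto intro!: derivative_eq_intros)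
    show "isCont f (g a)" if "0 < ereal a" for a
    proof -
      have "0 < g a" using that y by (simp add: g_def)
      then show ?thesis
        unfolding f_def by (intro continuous_intros) auto
    qed
    show "isCont g' a" if "0 < ereal a" for a
      unfolding g'_def using that y by (intro continuous_intros) auto
    show "0 \<le> f (g a)" for a
      unfolding f_def by simp
    show "0 \<le> g' a" for a
      unfolding g'_def using q y by simp
    show "((ereal \<circ> g \<circ> real_of_ereal) \<longlongrightarrow> 0) (at_right 0)"
    proof -
      have "(g \<longlongrightarrow> 0) (at_right 0)"
        unfolding g_def using q y
        by (auto intro!: tendsto_eq_intros eventually_mono[OF eventually_at_right_less])
      then show ?thesis
        unfolding zero_ereal_def ereal_tendsto_simps1 ereal_tendsto_simps2 .
    qed
    show "((ereal \<circ> g \<circ> real_of_ereal) \<longlongrightarrow> \<infinity>) (at_left \<infinity>)"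
    proof -
      have "filterlim g at_top at_top"
        unfolding g_def using q y by real_asymp
      then show ?thesis
        by (simp add: ereal_tendsto_simps)
    qed
    show "set_integrable lborel (einterval 0 \<infinity>) (\<lambda>a. f (g a) * g' a)"
      using sub by (simp add: einterval_eq zero_ereal_def)
  qed
  then have "(LBINT z:{0<..}. f z) = (LBINT a:{0<..}. f (g a) * g' a)"
    by (simp add: interval_integral_to_infinity_eq zero_ereal_def)
  also have "\<dots> = (LBINT a:{0<..}. q * y powr (1 / p - 1 / q) * (1 / barrier p q y a))"
    by (rule set_lebesgue_integral_cong) (auto simp: eq)
  also have "\<dots> = q * y powr (1 / p - 1 / q) * (LBINT a:{0<..}. 1 / barrier p q y a)"
    by (rule set_integral_mult_right)
  finally show ?thesis
    using q unfolding rate_def f_def by simp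
qed

lemma integral_inverse_barrier_tendsto:
  "((\<lambda>u. integral {0..u} (\<lambda>a. 1 / barrier p q y a)) \<longlongrightarrow> y powr (1 / q - 1 / p) * rate p q) at_top"
proof -
  have "((\<lambda>u. LBINT a:{0..u}. 1 / barrier p q y a) \<longlongrightarrow> (LBINT a:{0..}. 1 / barrier p q y a)) at_top"
    by (rule tendsto_set_lebesgue_integral_at_top[OF _ inverse_barrier_integrable]) simp
  also have "(\<lambda>u. LBINT a:{0..u}. 1 / barrier p q y a) = (\<lambda>u. integral {0..u} (\<lambda>a. 1 / barrier p q y a))"
    by (intro ext set_borel_integral_eq_integral(2) set_integrable_subset[OF inverse_barrier_integrable]) auto
  also have "(LBINT a:{0..}. 1 / barrier p q y a) = (LBINT a:{0<..}. 1 / barrier p q y a)"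
    unfolding set_lebesgue_integral_def
  proof (rule integral_cong_AE)
    show "AE a in lborel. indicator {0..} a *\<^sub>R (1 / barrier p q y a) = indicator {0<..} a *\<^sub>R (1 / barrier p q y a)"
      using AE_lborel_singleton[of "0::real"] by eventually_elim (auto simp: indicator_def)
  qed auto
  also have "\<dots> = y powr (1 / q - 1 / p) * rate p q"
  proof -
    have "y powr (1 / q - 1 / p) * y powr (1 / p - 1 / q) = 1"
      using y by (simp add: powr_add[symmetric])
    then show ?thesis
      unfolding rate_substitution mult.assoc[symmetric] by simp
  qed
  finally show ?thesis .
qed

end

text \<open>At y = 1 the power of \<open>y\<close> disappears, so \<open>rate\<close> is the limit
  of the integrals of 1 / \<phi>; the part over \<open>{0..1}\<close> already bounds it
  below.\<close>

lemma rate_pos: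
  assumes p: "0 < p" and pq: "p < q"
  shows "0 < rate p q"
proof -
  let ?b = "barrier p q 1"
  note b = barrier_pos[OF p pq zero_less_one]
  have int: "(\<lambda>a. 1 / ?b a) integrable_on {0..u}" for u
    by (rule set_borel_integral_eq_integral(1))
       (auto intro: set_integrable_subset[OF inverse_barrier_integrable[OF p pq zero_less_one]])
  have "integral {0..1::real} (\<lambda>a. 1 / ?b 1) \<le> integral {0..u} (\<lambda>a. 1 / ?b a)" if "1 \<le> u" for u
  proof -
    have "integral {0..1::real} (\<lambda>a. 1 / ?b 1) \<le> integral {0..1} (\<lambda>a. 1 / ?b a)"
    proof (rule integral_le[OF _ int])
      fix a :: real assume "a \<in> {0..1}"
      then show "1 / ?b 1 \<le> 1 / ?b a"
        using b by (intro divide_left_mono mono_onD[OF barrier_mono[OF p pq zero_less_one]]) auto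
    qed auto
    also have "\<dots> \<le> integral {0..u} (\<lambda>a. 1 / ?b a)"
      using that by (intro integral_subset_le int) (auto intro: less_imp_le b)
    finally show ?thesis .
  qed
  then have "\<forall>\<^sub>F u in at_top. 1 / ?b 1 \<le> integral {0..u} (\<lambda>a. 1 / ?b a)"
    by (intro eventually_at_top_linorderI[of 1]) simp
  then have "1 / ?b 1 \<le> 1 powr (1 / q - 1 / p) * rate p q"
    by (intro tendsto_lowerbound[OF integral_inverse_barrier_tendsto[OF p pq zero_less_one]]) auto
  then show ?thesis
    using b[of 1] by (simp add: less_le_trans[of 0 "1 / ?b 1"])
qed

section \<open>The law of the supremum\<close>

text \<open>The barrier argument covers positive levels and nonnegativity of the supremum the
  negative ones. Right-continuity fills the gap at 0.\<close>

lemma cdf_unique_except: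
  assumes M1: "real_distribution M1" and M2: "real_distribution M2"
    and eq: "\<And>y. y \<noteq> a \<Longrightarrow> cdf M1 y = cdf M2 y"
  shows "M1 = M2"
proof (rule cdf_unique[OF M1 M2], rule ext)
  interpret M1: real_distribution M1 by (rule M1)
  interpret M2: real_distribution M2 by (rule M2)
  fix y
  show "cdf M1 y = cdf M2 y"
  proof (cases "y = a")
    case True
    have 1: "(cdf M1 \<longlongrightarrow> cdf M1 a) (at_right a)" and 2: "(cdf M2 \<longlongrightarrow> cdf M2 a) (at_right a)"
      using M1.cdf_is_right_cont M2.cdf_is_right_cont by (simp_all add: continuous_within)
    have "\<forall>\<^sub>F y in at_right a. cdf M1 y = cdf M2 y"
      using eventually_at_right_less[of a] by eventually_elim (simp add: eq)
    then have "(cdf M2 \<longlongrightarrow> cdf M1 a) (at_right a)"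
      by (rule Lim_transform_eventually[OF 1])
    then show ?thesis
      using True tendsto_unique[OF trivial_limit_at_right_real _ 2] by simp
  qed (rule eq)
qed

text \<open>A negative exponent reverses the inequality and turns a lower tail of the power into an
  upper tail of \<open>e\<close>.\<close>

lemma (in prob_space) prob_exponential_powr_le:
  assumes e: "distributed M lborel e (exponential_density c)" and c: "0 < c" and r: "r < 0" and y: "0 < y"
  shows "prob {\<omega>\<in>space M. e \<omega> powr r \<le> y} = exp (- (y powr (1 / r) * c))"
proof -
  let ?b = "y powr (1 / r)"
  have [measurable]: "e \<in> borel_measurable M"
    using distributed_measurable[OF e] by simp
  have "prob {\<omega>\<in>space M. e \<omega> \<le> 0} = 0"
    using exponential_distributedD_le[OF e order_refl c] by simp
  then have pos: "AE \<omega> in M. 0 < e \<omega>"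
    by (subst (asm) prob_eq_0) (auto simp: not_le)
  \<comment> \<open>Discarding the atomless value \<open>?b\<close> turns the reversed inequality
    into the strict one of the exponential tail formula.\<close>
  have ne: "AE \<omega> in M. e \<omega> \<noteq> ?b"
    using AE_lborel_singleton[of ?b] by (subst distributed_AE2[OF e]) auto
  have "prob {\<omega>\<in>space M. e \<omega> powr r \<le> y} = prob {\<omega>\<in>space M. ?b < e \<omega>}"
  proof (rule finite_measure_eq_AE)
    show "AE \<omega> in M. \<omega> \<in> {\<omega>\<in>space M. e \<omega> powr r \<le> y} \<longleftrightarrow> \<omega> \<in> {\<omega>\<in>space M. ?b < e \<omega>}"
      using pos ne
    proof eventually_elim
      case (elim \<omega>)
      have "?b powr r = y"
        using y r by (simp add: powr_powr)
      moreover have "e \<omega> powr r \<le> ?b powr r \<longleftrightarrow> ?b \<le> e \<omega>"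
        using elim r y powr_less_mono2_neg[of r "e \<omega>" ?b] powr_less_mono2_neg[of r ?b "e \<omega>"]
        by (cases "e \<omega>" ?b rule: linorder_cases) auto
      ultimately show ?case
        using elim by auto
    qed
  qed auto
  also have "\<dots> = exp (- (?b * c))"
    using exponential_distributedD_gt[OF e _ c, of ?b] by simp
  finally show ?thesis .
qed

section \<open>Distribution function of the supremum, one barrier for each positive level\<close>

locale sigma_power_process = usual_filtered_prob_space M F
  for M :: "'a measure" and F +
  fixes X N A :: "real \<Rightarrow> 'a \<Rightarrow> real" and p q :: real
  assumes class_Sigma: "class_Sigma M F X N A"
    and jumps: "only_negative_jumps M X"
    and A_top: "AE \<omega> in M. filterlim (\<lambda>t. A t \<omega>) at_top at_top"
    and p: "0 < p" and pq: "p < q"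
begin

abbreviation S :: "'a \<Rightarrow> ereal" where "S \<equiv> sup_power_diff X A p q"

lemma sigma_process_barrier: "0 < y \<Longrightarrow> sigma_process M F X N A (barrier p q y)"
  using class_Sigma jumps A_top barrier_cont[OF p pq] barrier_mono[OF p pq] barrier_pos[OF p pq]
    barrier_borel[OF p pq]
  by unfold_locales auto

lemma sup_power_diff_le:
  assumes y: "0 < y"
  shows "{\<omega>\<in>space M. S \<omega> \<le> ereal y} \<in> sets M"
    and "prob {\<omega>\<in>space M. S \<omega> \<le> ereal y} = exp (- (y powr (1 / q - 1 / p) * rate p q))"
proof -
  interpret B: sigma_process M F X N A "barrier p q y"
    by (rule sigma_process_barrier[OF y])
  note never = B.never_exceeds[OF integral_inverse_barrier_tendsto[OF p pq y]]
  let ?E = "{\<omega>\<in>space M. \<forall>t\<ge>0. X t \<omega> \<le> barrier p q y (A t \<omega>)}"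
  have eq: "AE \<omega> in M. \<omega> \<in> ?E \<longleftrightarrow> \<omega> \<in> {\<omega>\<in>space M. S \<omega> \<le> ereal y}"
    using B.AE_good
  proof eventually_elim
    case (elim \<omega>)
    have "X t \<omega> powr p - A t \<omega> powr q \<le> y \<longleftrightarrow> X t \<omega> \<le> barrier p q y (A t \<omega>)" if "0 \<le> t" for t
      using sigma_path.x_nonneg[OF B.good_path[OF elim] that] by (rule le_barrier_iff[OF p pq y])
    then show ?case
      by (auto simp: sup_power_diff_def SUP_le_iff)
  qed
  show S: "{\<omega>\<in>space M. S \<omega> \<le> ereal y} \<in> sets M"
    by (rule in_sets_AE[OF eq never(1)]) auto
  show "prob {\<omega>\<in>space M. S \<omega> \<le> ereal y} = exp (- (y powr (1 / q - 1 / p) * rate p q))"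
    using finite_measure_eq_AE[OF eq never(1) S] never(2) by simp
qed

lemma AE_sup_power_diff_nonneg: "AE \<omega> in M. 0 \<le> S \<omega>"
proof -
  interpret B: sigma_process M F X N A "barrier p q 1"
    by (rule sigma_process_barrier) simp
  show ?thesis
    using B.AE_good
  proof eventually_elim
    case (elim \<omega>)
    have "ereal (X 0 \<omega> powr p - A 0 \<omega> powr q) \<le> S \<omega>"
      unfolding sup_power_diff_def by (rule SUP_upper) simp
    then show ?case
      using sigma_path.x_0[OF B.good_path[OF elim]] sigma_path.a_0[OF B.good_path[OF elim]]
      by (simp add: zero_ereal_def)
  qed
qed

text \<open>The exponent 1/q - 1/p is negative, so the probability of staying below a level tends to
  1 as the level grows. The levels \<open>Suc n\<close> avoid 0, where no barrier is
  available.\<close>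

lemma AE_sup_power_diff_finite: "AE \<omega> in M. S \<omega> \<noteq> \<infinity>"
proof -
  have neg: "1 / q - 1 / p < 0"
    using p pq by (simp add: frac_less2)
  have "(\<lambda>n. prob {\<omega>\<in>space M. S \<omega> \<le> ereal (real (Suc n))}) \<longlonglongrightarrow> prob (\<Union>n. {\<omega>\<in>space M. S \<omega> \<le> ereal (real (Suc n))})"
  proof (rule finite_Lim_measure_incseq)
    show "incseq (\<lambda>n. {\<omega>\<in>space M. S \<omega> \<le> ereal (real (Suc n))})"
      by (rule incseq_SucI) (auto elim: order_trans)
  qed (use sup_power_diff_le(1)[of "real (Suc _)"] in auto)
  moreover have "(\<lambda>n. prob {\<omega>\<in>space M. S \<omega> \<le> ereal (real (Suc n))}) \<longlonglongrightarrow> exp (- (0 * rate p q))"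
  proof -
    have "(\<lambda>n. real (Suc n) powr (1 / q - 1 / p)) \<longlonglongrightarrow> 0"
      by (rule tendsto_neg_powr[OF neg filterlim_compose[OF filterlim_real_sequentially filterlim_Suc]])
    then have "(\<lambda>n. exp (- (real (Suc n) powr (1 / q - 1 / p) * rate p q))) \<longlonglongrightarrow> exp (- (0 * rate p q))"
      by (intro tendsto_intros)
    then show ?thesis
      by (simp add: sup_power_diff_le(2) del: of_nat_Suc)
  qed
  ultimately have "prob (\<Union>n. {\<omega>\<in>space M. S \<omega> \<le> ereal (real (Suc n))}) = 1"
    using LIMSEQ_unique by fastforce
  then have "AE \<omega> in M. \<omega> \<in> (\<Union>n. {\<omega>\<in>space M. S \<omega> \<le> ereal (real (Suc n))})"
    by (subst (asm) prob_eq_1) (use sup_power_diff_le(1)[of "real (Suc _)"] in auto)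
  then show ?thesis
    by eventually_elim auto
qed

text \<open>For an uncountable supremum, measurability comes from its sublevel sets: positive levels
  are barrier events, level 0 is their countable intersection, and negative levels are almost surely
  empty.\<close>

lemma sup_power_diff_measurable [measurable]: "S \<in> borel_measurable M"
proof (rule borel_measurableI_le)
  fix y :: ereal
  show "{\<omega>\<in>space M. S \<omega> \<le> y} \<in> sets M"
  proof (cases y)
    case (real r)
    consider "0 < r" | "r = 0" | "r < 0" by linarith
    then show ?thesis
    proof cases
      case 1
      then show ?thesis using sup_power_diff_le(1) real by simp
    next
      case 2
      have "{\<omega>\<in>space M. S \<omega> \<le> y} = (\<Inter>n. {\<omega>\<in>space M. S \<omega> \<le> ereal (1 / real (Suc n))})"
      proof (intro set_eqI iffI)
        fix \<omega> assume *: "\<omega> \<in> (\<Inter>n. {\<omega>\<in>space M. S \<omega> \<le> ereal (1 / real (Suc n))})"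
        have "S \<omega> \<le> 0"
        proof (rule LIMSEQ_le_const)
          show "(\<lambda>n. ereal (1 / real (Suc n))) \<longlonglongrightarrow> 0"
            using LIMSEQ_inverse_real_of_nat by (simp add: zero_ereal_def inverse_eq_divide)
        qed (use * in auto)
        then show "\<omega> \<in> {\<omega>\<in>space M. S \<omega> \<le> y}"
          using * 2 real by (auto simp: zero_ereal_def)
      qed (use 2 real in \<open>auto intro: order_trans\<close>)
      also have "\<dots> \<in> sets M"
        by (intro sets.countable_INT) (use sup_power_diff_le(1)[of "1 / real (Suc _)"] in auto)
      finally show ?thesis .
    next
      case 3
      show ?thesis
      proof (rule in_sets_AE)
        show "AE \<omega> in M. \<omega> \<in> {} \<longleftrightarrow> \<omega> \<in> {\<omega>\<in>space M. S \<omega> \<le> y}"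
          using AE_sup_power_diff_nonneg
        proof eventually_elim
          case (elim \<omega>)
          have "y < 0" using 3 real by (simp add: zero_ereal_def)
          then have "\<not> S \<omega> \<le> y" using elim by (meson leD le_less_trans)
          then show ?case by simp
        qed
      qed auto
    qed
  next
    case PInf
    then show ?thesis by simp
  next
    case MInf
    show ?thesis
    proof (rule in_sets_AE)
      show "AE \<omega> in M. \<omega> \<in> {} \<longleftrightarrow> \<omega> \<in> {\<omega>\<in>space M. S \<omega> \<le> y}"
        using AE_sup_power_diff_nonneg by eventually_elim (auto simp: MInf)
    qed auto
  qed
qed

lemma sup_power_diff_law:
  assumes M': "prob_space M'" and e: "distributed M' lborel e (exponential_density (rate p q))"
  shows "distr M borel S = distr M' borel (\<lambda>\<omega>. ereal (e \<omega> powr (p * q / (p - q))))"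
proof -
  interpret M': prob_space M' by (rule M')
  define r where "r = p * q / (p - q)"
  have r: "r < 0"
    unfolding r_def using p pq by (intro divide_pos_neg) auto
  \<comment> \<open>The power of \<open>y\<close> in the distribution function is the reciprocal of
    the exponent in the statement; this is where p q / (p - q) comes from.\<close>
  have inv_r: "1 / r = 1 / q - 1 / p"
    unfolding r_def using p pq by (simp add: field_simps)
  \<comment> \<open>A real-valued version gives access to distribution functions on the reals; the
    laws are pushed back along \<open>ereal\<close> at the end.\<close>
  define s where "s \<omega> = real_of_ereal (S \<omega>)" for \<omega>
  have [measurable]: "s \<in> borel_measurable M"
    unfolding s_def by measurable
  have [measurable]: "e \<in> borel_measurable M'"
    using distributed_measurable[OF e] by simp
  have s_eq: "AE \<omega> in M. S \<omega> = ereal (s \<omega>)"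
    using AE_sup_power_diff_nonneg AE_sup_power_diff_finite by eventually_elim (auto simp: s_def ereal_real)
  have "distr M borel s = distr M' borel (\<lambda>\<omega>. e \<omega> powr r)"
  proof (rule cdf_unique_except[where a = 0])
    show "real_distribution (distr M borel s)"
      by (rule real_distribution_distr) simp
    show "real_distribution (distr M' borel (\<lambda>\<omega>. e \<omega> powr r))"
      by (rule M'.real_distribution_distr) simp
    fix y :: real assume "y \<noteq> 0"
    have cdf_s: "cdf (distr M borel s) y = prob {\<omega>\<in>space M. s \<omega> \<le> y}"
      by (auto simp: cdf_def measure_distr vimage_def intro!: arg_cong[where f = prob])
    have cdf_e: "cdf (distr M' borel (\<lambda>\<omega>. e \<omega> powr r)) y = M'.prob {\<omega>\<in>space M'. e \<omega> powr r \<le> y}"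
      by (auto simp: cdf_def measure_distr vimage_def intro!: arg_cong[where f = M'.prob])
    have s_S: "prob {\<omega>\<in>space M. s \<omega> \<le> y} = prob {\<omega>\<in>space M. S \<omega> \<le> ereal y}"
      by (rule finite_measure_eq_AE) (use s_eq in \<open>auto elim: eventually_mono\<close>)
    show "cdf (distr M borel s) y = cdf (distr M' borel (\<lambda>\<omega>. e \<omega> powr r)) y"
    proof (cases "0 < y")
      case True
      then show ?thesis
        unfolding cdf_s cdf_e s_S sup_power_diff_le(2)[OF True]
          M'.prob_exponential_powr_le[OF e rate_pos[OF p pq] r True] inv_r by simp
    next
      case False
      then have "y < 0" using \<open>y \<noteq> 0\<close> by simp
      have "prob {\<omega>\<in>space M. S \<omega> \<le> ereal y} = prob {}"
      proof (rule finite_measure_eq_AE)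
        show "AE \<omega> in M. \<omega> \<in> {\<omega>\<in>space M. S \<omega> \<le> ereal y} \<longleftrightarrow> \<omega> \<in> {}"
          using AE_sup_power_diff_nonneg
        proof eventually_elim
          case (elim \<omega>)
          have "ereal y < 0" using \<open>y < 0\<close> by simp
          then have "\<not> S \<omega> \<le> ereal y" using elim by (meson leD le_less_trans)
          then show ?case by simp
        qed
      qed auto
      moreover have "{\<omega>\<in>space M'. e \<omega> powr r \<le> y} = {}"
        using \<open>y < 0\<close> by (auto simp: not_le intro: less_le_trans)
      ultimately show ?thesis
        unfolding cdf_s cdf_e s_S by (simp only: measure_empty)
    qed
  qed
  then have "distr (distr M borel s) borel ereal = distr (distr M' borel (\<lambda>\<omega>. e \<omega> powr r)) borel ereal"
    by simp
  then have "distr M borel (\<lambda>\<omega>. ereal (s \<omega>)) = distr M' borel (\<lambda>\<omega>. ereal (e \<omega> powr r))"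
    by (simp add: distr_distr comp_def)
  moreover have "distr M borel S = distr M borel (\<lambda>\<omega>. ereal (s \<omega>))"
    by (rule distr_cong_AE) (use s_eq in auto)
  ultimately show ?thesis
    by (simp add: r_def)
qed

end

theorem corollary3p10:
  fixes M :: "'a measure" and F :: "real \<Rightarrow> 'a measure"
    and X N A :: "real \<Rightarrow> 'a \<Rightarrow> real" and p q :: real
  assumes "usual_filtered_prob_space M F"
    and "class_Sigma M F X N A"
    and "only_negative_jumps M X"
    and "AE \<omega> in M. filterlim (\<lambda>t. A t \<omega>) at_top at_top"
    and "0 < p" and "p < q"
  shows "0 < rate p q \<and>
    sup_power_diff X A p q \<in> borel_measurable M \<and>
    (\<forall>(M' :: 'b measure) e. prob_space M' \<longrightarrow>
       distributed M' lborel e (exponential_density (rate p q)) \<longrightarrow>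
       distr M borel (sup_power_diff X A p q) =
       distr M' borel (\<lambda>\<omega>. ereal (e \<omega> powr (p * q / (p - q)))))"
proof -
  interpret sigma_power_process M F X N A p q
    using assms by (simp add: sigma_power_process_def sigma_power_process_axioms_def)
  show ?thesis
    using rate_pos[OF p pq] sup_power_diff_measurable sup_power_diff_law by blast
qed

end
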